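(* Let $E\in\mathbb{C}^{n\times n}$ and $G\in\mathbb{C}^{m\times m}$ be Hermitian, $F,H\in\mathbb{C}^{m\times n}$, $q\in\mathbb{C}^n$, $r\in\mathbb{C}^m$, with $\begin{bmatrix}E&F^*\\ H&G\end{bmatrix}$ nonsingular, let $\alpha_1,\alpha_2,\alpha_3,\alpha_4,\beta_1,\beta_2>0$, and let $\widehat{x}=[\widehat u^{T},\widehat p^{T}]^{T}$ with $\widehat u\in\mathbb{C}^n$, $\widehat p\in\mathbb{C}^m$ be an approximate solution of $\begin{bmatrix}E&F^*\\ H&G\end{bmatrix}\begin{bmatrix}u\\ p\end{bmatrix}=\begin{bmatrix}q\\ r\end{bmatrix}$. Put $Q=q-E\widehat u-F^*\widehat p$, $R=r-H\widehat u-G\widehat p$, $\mathcal{I}_1=[-\beta_1^{-1}I_{2n}\;\;0_{2n\times 2m}]$, $\mathcal{I}_2=[0_{2m\times 2n}\;\;-\beta_2^{-1}I_{2m}]$, $\mathbf{M}_1=[\widehat{\mathbf{X}}_1\;\;0_{2n\times(m^2+2mn)}]$, $\mathbf{M}_2=[0_{2m\times(n^2+2mn)}\;\;\widehat{\mathbf{M}}_2]$, where $$\widehat{\mathbf{X}}_1=\begin{bmatrix}\alpha_1^{-1}(\Re(\widehat u)^T\otimes I_n)N_1&-\alpha_1^{-1}(\Im(\widehat u)^T\otimes I_n)N_2&\alpha_2^{-1}(I_n\otimes\Re(\widehat p)^T)\Sigma_F&\alpha_2^{-1}(I_n\otimes\Im(\widehat p)^T)\Sigma_F\\ \alpha_1^{-1}(\Im(\widehat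 u)^T\otimes I_n)N_1&\alpha_1^{-1}(\Re(\widehat u)^T\otimes I_n)N_2&\alpha_2^{-1}(I_n\otimes\Im(\widehat p)^T)\Sigma_F&-\alpha_2^{-1}(I_n\otimes\Re(\widehat p)^T)\Sigma_F\end{bmatrix},$$ $$\widehat{\mathbf{M}}_2=\begin{bmatrix}\alpha_3^{-1}(\Re(\widehat u)^T\otimes I_m)\Sigma_H&-\alpha_3^{-1}(\Im(\widehat u)^T\otimes I_m)\Sigma_H&\alpha_4^{-1}(\Re(\widehat p)^T\otimes I_m)S_1&-\alpha_4^{-1}(\Im(\widehat p)^T\otimes I_m)S_2\\ \alpha_3^{-1}(\Im(\widehat u)^T\otimes I_m)\Sigma_H&\alpha_3^{-1}(\Re(\widehat u)^T\otimes I_m)\Sigma_H&\alpha_4^{-1}(\Im(\widehat p)^T\otimes I_m)S_1&\alpha_4^{-1}(\Re(\widehat p)^T\otimes I_m)S_2\end{bmatrix}.$$ Then the sparsity-preserving structured backward error is $$\xi^{\mathcal{G}_3}_{\rm sps}(\widehat u,\widehat p)=\left\|\begin{bmatrix}\mathbf{M}_1&\mathcal{I}_1\\ \mathbf{M}_2&\mathcal{I}_2\end{bmatrix}^T\left(\begin{bmatrix}\mathbf{M}_1&\mathcal{I}_1\\ \mathbf{M}_2&\mathcal{I}_2\end{bmatrix}\begin{bmatrix}\mathbf{M}_1&\mathcal{I}_1\\ \mathbf{M}_2&\mathcal{I}_2\end{bmatrix}^T\right)^{-1}\begin{bmatrix}\Re(Q)\\ \Im(Q)\\ \Re(R)\\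 \Im(R)\end{bmatrix}\right\|_2 .$$
   Context: Notation. $\Re,\Im$ are entrywise real and imaginary parts, $T$ is transpose, $*$ is conjugate transpose, $\otimes$ is the Kronecker product, $\odot$ the entrywise product, and $\mathrm{vec}$ stacks columns. For a matrix $X$, $\Theta_X$ is the matrix of the same size with entry $1$ where $X$ has a nonzero entry and $0$ where $X$ has a zero entry; $\Sigma_X=\mathrm{diag}(\mathrm{vec}(\Theta_X))$. For a real symmetric $k\times k$ matrix $Z$, $\mathrm{vec}_S(Z)\in\mathbb{R}^{k(k+1)/2}$ stacks the columns of the lower triangle including the diagonal: $(z_{11},\dots,z_{k1},z_{22},\dots,z_{k2},\dots,z_{kk})^T$. For a real skew-symmetric $Z$, $\mathrm{vec}_{SK}(Z)\in\mathbb{R}^{k(k-1)/2}$ stacks the columns of the strict lower triangle: $(z_{21},\dots,z_{k1},z_{32},\dots,z_{k2},\dots,z_{k(k-1)})^T$. $\mathcal{J}^k_S\in\mathbb{R}^{k^2\times k(k+1)/2}$ and $\mathcal{J}^k_{SK}\in\mathbb{R}^{k^2\times k(k-1)/2}$ are the matrices with $\mathrm{vec}(Z)=\mathcal{J}^k_S\mathrm{vec}_S(Z)$ for all real symmetric $Z$ and $\mathrm{vec}(Z)=\mathcal{J}^k_{SK}\mathrm{vec}_{SK}(Z)$ for all real skew-symmetric $Z$. For Hermitian $X$ of size $k$, $\Phi_X=\mathrm{diag}(\mathrm{vec}_S(\Theta_X))$ and $\Psi_X$ is the diagonal matrix whose diagonal is $(\Theta_X(1,2),\dots,\Theta_X(1,k),\Theta_X(2,3),\dots,\Theta_X(2,k),\dots,\Theta_X(k-1,k))$.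 $\mathfrak{D}_{S,k}$ is the diagonal matrix of size $k(k+1)/2$ with entry $1$ at the positions that $\mathrm{vec}_S$ assigns to diagonal entries, i.e. $j=\frac{(2k-(i-2))(i-1)}{2}+1$, $i=1,\dots,k$, and $\sqrt2$ at all other positions; $\mathfrak{D}_{SK,k}=\sqrt2\,I_{k(k-1)/2}$. Set $N_1=\mathcal{J}^n_S\Phi_E\mathfrak{D}_{S,n}^{-1}$, $N_2=\mathcal{J}^n_{SK}\Psi_E\mathfrak{D}_{SK,n}^{-1}$, $S_1=\mathcal{J}^m_S\Phi_G\mathfrak{D}_{S,m}^{-1}$, $S_2=\mathcal{J}^m_{SK}\Psi_G\mathfrak{D}_{SK,m}^{-1}$. Structured backward error. $\mathcal{G}_3$ is the set of tuples $(\Delta E,\Delta F,\Delta H,\Delta G,\Delta q,\Delta r)$ with $\Delta E\in\mathbb{C}^{n\times n}$ and $\Delta G\in\mathbb{C}^{m\times m}$ Hermitian, $\Delta F,\Delta H\in\mathbb{C}^{m\times n}$, $\Delta q\in\mathbb{C}^n$, $\Delta r\in\mathbb{C}^m$ such that $$\begin{bmatrix}E+\Delta E&(F+\Delta F)^*\\ H+\Delta H&G+\Delta G\end{bmatrix}\begin{bmatrix}\widehat u\\ \widehat p\end{bmatrix}=\begin{bmatrix}q+\Delta q\\ r+\Delta r\end{bmatrix}.$$ Let $\zeta^{\sigma_2}(\Delta E,\Delta F,\Delta H,\Delta G,\Delta q,\Delta r)=\sqrt{\alpha_1^2\|\Delta E\|_F^2+\alpha_2^2\|\Delta F\|_F^2+\alpha_3^2\|\Delta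 H\|_F^2+\alpha_4^2\|\Delta G\|_F^2+\beta_1^2\|\Delta q\|_2^2+\beta_2^2\|\Delta r\|_2^2}$ ($\|\cdot\|_F$ the Frobenius norm). The sparsity-preserving structured backward error $\xi^{\mathcal{G}_3}_{\rm sps}(\widehat u,\widehat p)$ is the minimum of $\zeta^{\sigma_2}(\Delta E\odot\Theta_E,\Delta F\odot\Theta_F,\Delta H\odot\Theta_H,\Delta G\odot\Theta_G,\Delta q,\Delta r)$ over all perturbations with $(\Delta E\odot\Theta_E,\Delta F\odot\Theta_F,\Delta H\odot\Theta_H,\Delta G\odot\Theta_G,\Delta q,\Delta r)\in\mathcal{G}_3$. *)

theory Defs
  imports
    Complex_Main
    "Jordan_Normal_Form.Schur_Decomposition"
    "Jordan_Normal_Form.Gauss_Jordan_Elimination"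
begin

section \<open>Matrix notation\<close>

definition hermitian_mat :: "complex mat \<Rightarrow> bool" where
  "hermitian_mat A \<longleftrightarrow> mat_adjoint A = A"

definition append_cols :: "'a :: zero mat \<Rightarrow> 'a mat \<Rightarrow> 'a mat" (infixr \<open>@\<^sub>c\<close> 65) where
  "A @\<^sub>c B = four_block_mat A B (0\<^sub>m 0 (dim_col A)) (0\<^sub>m 0 (dim_col B))"

definition kronecker :: "'a :: times mat \<Rightarrow> 'a mat \<Rightarrow> 'a mat" (infixl \<open>\<otimes>\<^sub>m\<close> 70) where
  "A \<otimes>\<^sub>m B = mat (dim_row A * dim_row B) (dim_col A * dim_col B)
     (\<lambda>(i, j). A $$ (i div dim_row B, j div dim_col B) * B $$ (i mod dim_row B, j mod dim_col B))"

definition hadamard :: "'a :: times mat \<Rightarrow> 'a mat \<Rightarrow> 'a mat" (infixl \<open>\<odot>\<^sub>m\<close> 70) where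
  "A \<odot>\<^sub>m B = mat (dim_row A) (dim_col A) (\<lambda>(i, j). A $$ (i, j) * B $$ (i, j))"

text \<open>Column stacking: with zero-based indices, entry \<open>(i, j)\<close> goes to position
  \<open>j * dim_row A + i\<close>.\<close>

definition vec_cols :: "'a mat \<Rightarrow> 'a vec" where
  "vec_cols A = vec (dim_row A * dim_col A) (\<lambda>k. A $$ (k mod dim_row A, k div dim_row A))"

definition diag_of_vec :: "'a :: zero vec \<Rightarrow> 'a mat" where
  "diag_of_vec v = mat_diag (dim_vec v) (\<lambda>i. v $ i)"

text \<open>Only meaningful for invertible matrices.\<close>

definition inv_mat :: "'a :: field mat \<Rightarrow> 'a mat" where
  "inv_mat A = the (mat_inverse A)"

definition norm2 :: "'a :: real_normed_vector vec \<Rightarrow> real" where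
  "norm2 v = sqrt (\<Sum>i<dim_vec v. (norm (v $ i))\<^sup>2)"

definition norm_F :: "'a :: real_normed_vector mat \<Rightarrow> real" where
  "norm_F A = sqrt (\<Sum>i<dim_row A. \<Sum>j<dim_col A. (norm (A $$ (i, j)))\<^sup>2)"

section \<open>Sparsity patterns and stacking of (skew-)symmetric matrices\<close>

text \<open>The result type of the pattern is left open: it is used as a complex matrix when it masks a
  perturbation, and as a real matrix inside \<open>Sigma\<close>, \<open>Phi\<close> and \<open>Psi\<close>.\<close>

definition Theta :: "'a :: zero mat \<Rightarrow> 'b :: zero_neq_one mat" where
  "Theta X = map_mat (\<lambda>x. if x = 0 then 0 else 1) X"

definition Sigma_mat :: "complex mat \<Rightarrow> real mat" where
  "Sigma_mat X = diag_of_vec (vec_cols (Theta X))"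

text \<open>Zero-based index pairs \<open>(row, column)\<close>: lower triangle by columns, strict lower triangle by
  columns, strict upper triangle by rows.\<close>

definition lower_pairs :: "nat \<Rightarrow> (nat \<times> nat) list" where
  "lower_pairs k = [(i, j). j \<leftarrow> [0..<k], i \<leftarrow> [j..<k]]"

definition strict_lower_pairs :: "nat \<Rightarrow> (nat \<times> nat) list" where
  "strict_lower_pairs k = [(i, j). j \<leftarrow> [0..<k], i \<leftarrow> [Suc j..<k]]"

definition strict_upper_pairs :: "nat \<Rightarrow> (nat \<times> nat) list" where
  "strict_upper_pairs k = [(i, j). i \<leftarrow> [0..<k], j \<leftarrow> [Suc i..<k]]"

definition entries_at :: "(nat \<times> nat) list \<Rightarrow> 'a mat \<Rightarrow> 'a vec" where
  "entries_at ps Z = vec_of_list (map (\<lambda>ij. Z $$ ij) ps)"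

definition vec_S :: "real mat \<Rightarrow> real vec" where
  "vec_S Z = entries_at (lower_pairs (dim_row Z)) Z"

definition vec_SK :: "real mat \<Rightarrow> real vec" where
  "vec_SK Z = entries_at (strict_lower_pairs (dim_row Z)) Z"

text \<open>Existence and uniqueness of the matrices chosen here are proved in \<open>ex1_J_S\<close> and
  \<open>ex1_J_SK\<close> below.\<close>

definition J_S :: "nat \<Rightarrow> real mat" where
  "J_S k = (THE J. J \<in> carrier_mat (k * k) (k * (k + 1) div 2) \<and>
     (\<forall>Z \<in> carrier_mat k k. transpose_mat Z = Z \<longrightarrow> vec_cols Z = J *\<^sub>v vec_S Z))"

definition J_SK :: "nat \<Rightarrow> real mat" where
  "J_SK k = (THE J. J \<in> carrier_mat (k * k) (k * (k - 1) div 2) \<and>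
     (\<forall>Z \<in> carrier_mat k k. transpose_mat Z = - Z \<longrightarrow> vec_cols Z = J *\<^sub>v vec_SK Z))"

definition Phi :: "complex mat \<Rightarrow> real mat" where
  "Phi X = diag_of_vec (vec_S (Theta X))"

definition Psi :: "complex mat \<Rightarrow> real mat" where
  "Psi X = diag_of_vec (entries_at (strict_upper_pairs (dim_row X)) (Theta X))"

text \<open>That the diagonal positions are the ones given by the closed formula is \<open>lower_pairs_diag\<close>
  below.\<close>

definition D_S :: "nat \<Rightarrow> real mat" where
  "D_S k = mat_diag (k * (k + 1) div 2)
     (\<lambda>l. if fst (lower_pairs k ! l) = snd (lower_pairs k ! l) then 1 else sqrt 2)"

definition D_SK :: "nat \<Rightarrow> real mat" where
  "D_SK k = sqrt 2 \<cdot>\<^sub>m 1\<^sub>m (k * (k - 1) div 2)"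

text \<open>For \<open>X = E\<close> these are \<open>N\<^sub>1\<close>, \<open>N\<^sub>2\<close>; for \<open>X = G\<close> they are \<open>S\<^sub>1\<close>, \<open>S\<^sub>2\<close>.\<close>

definition N_S :: "complex mat \<Rightarrow> real mat" where
  "N_S X = J_S (dim_row X) * Phi X * inv_mat (D_S (dim_row X))"

definition N_SK :: "complex mat \<Rightarrow> real mat" where
  "N_SK X = J_SK (dim_row X) * Psi X * inv_mat (D_SK (dim_row X))"

section \<open>The structured backward error\<close>

definition saddle_mat :: "complex mat \<Rightarrow> complex mat \<Rightarrow> complex mat \<Rightarrow> complex mat \<Rightarrow> complex mat" where
  "saddle_mat E F H G = four_block_mat E (mat_adjoint F) H G"

type_synonym perturbation =
  "complex mat \<times> complex mat \<times> complex mat \<times> complex mat \<times> complex vec \<times> complex vec"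

definition G3 :: "nat \<Rightarrow> nat \<Rightarrow> complex mat \<Rightarrow> complex mat \<Rightarrow> complex mat \<Rightarrow> complex mat \<Rightarrow>
    complex vec \<Rightarrow> complex vec \<Rightarrow> complex vec \<Rightarrow> complex vec \<Rightarrow> perturbation set" where
  "G3 n m E F H G q r u p = {(dE, dF, dH, dG, dq, dr).
     dE \<in> carrier_mat n n \<and> hermitian_mat dE \<and> dG \<in> carrier_mat m m \<and> hermitian_mat dG \<and>
     dF \<in> carrier_mat m n \<and> dH \<in> carrier_mat m n \<and> dq \<in> carrier_vec n \<and> dr \<in> carrier_vec m \<and>
     saddle_mat (E + dE) (F + dF) (H + dH) (G + dG) *\<^sub>v (u @\<^sub>v p) = (q + dq) @\<^sub>v (r + dr)}"

definition zeta :: "real \<Rightarrow> real \<Rightarrow> real \<Rightarrow> real \<Rightarrow> real \<Rightarrow> real \<Rightarrow> perturbation \<Rightarrow> real" where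
  "zeta \<alpha>1 \<alpha>2 \<alpha>3 \<alpha>4 \<beta>1 \<beta>2 = (\<lambda>(dE, dF, dH, dG, dq, dr).
     sqrt (\<alpha>1\<^sup>2 * (norm_F dE)\<^sup>2 + \<alpha>2\<^sup>2 * (norm_F dF)\<^sup>2 + \<alpha>3\<^sup>2 * (norm_F dH)\<^sup>2 + \<alpha>4\<^sup>2 * (norm_F dG)\<^sup>2
       + \<beta>1\<^sup>2 * (norm2 dq)\<^sup>2 + \<beta>2\<^sup>2 * (norm2 dr)\<^sup>2))"

definition mask :: "complex mat \<Rightarrow> complex mat \<Rightarrow> complex mat \<Rightarrow> complex mat \<Rightarrow>
    perturbation \<Rightarrow> perturbation" where
  "mask E F H G = (\<lambda>(dE, dF, dH, dG, dq, dr).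
     (dE \<odot>\<^sub>m Theta E, dF \<odot>\<^sub>m Theta F, dH \<odot>\<^sub>m Theta H, dG \<odot>\<^sub>m Theta G, dq, dr))"

definition sps_values :: "nat \<Rightarrow> nat \<Rightarrow> real \<Rightarrow> real \<Rightarrow> real \<Rightarrow> real \<Rightarrow> real \<Rightarrow> real \<Rightarrow>
    complex mat \<Rightarrow> complex mat \<Rightarrow> complex mat \<Rightarrow> complex mat \<Rightarrow>
    complex vec \<Rightarrow> complex vec \<Rightarrow> complex vec \<Rightarrow> complex vec \<Rightarrow> real set" where
  "sps_values n m \<alpha>1 \<alpha>2 \<alpha>3 \<alpha>4 \<beta>1 \<beta>2 E F H G q r u p =
     {zeta \<alpha>1 \<alpha>2 \<alpha>3 \<alpha>4 \<beta>1 \<beta>2 (mask E F H G d) | d. mask E F H G d \<in> G3 n m E F H G q r u p}"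

text \<open>Since all values are nonnegative, the infimum below is the minimum exactly if it belongs to
  \<open>sps_values\<close>.\<close>

definition backward_error_sps :: "nat \<Rightarrow> nat \<Rightarrow> real \<Rightarrow> real \<Rightarrow> real \<Rightarrow> real \<Rightarrow> real \<Rightarrow> real \<Rightarrow>
    complex mat \<Rightarrow> complex mat \<Rightarrow> complex mat \<Rightarrow> complex mat \<Rightarrow>
    complex vec \<Rightarrow> complex vec \<Rightarrow> complex vec \<Rightarrow> complex vec \<Rightarrow> real" where
  "backward_error_sps n m \<alpha>1 \<alpha>2 \<alpha>3 \<alpha>4 \<beta>1 \<beta>2 E F H G q r u p =
     Inf (sps_values n m \<alpha>1 \<alpha>2 \<alpha>3 \<alpha>4 \<beta>1 \<beta>2 E F H G q r u p)"

section \<open>The matrices of the closed formula\<close>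

definition X1_hat :: "nat \<Rightarrow> real \<Rightarrow> real \<Rightarrow> complex mat \<Rightarrow> complex mat \<Rightarrow> complex vec \<Rightarrow> complex vec \<Rightarrow>
    real mat" where
  "X1_hat n \<alpha>1 \<alpha>2 E F u p =
    (let uR = mat_of_row (map_vec Re u); uI = mat_of_row (map_vec Im u);
         pR = mat_of_row (map_vec Re p); pI = mat_of_row (map_vec Im p) in
     (inverse \<alpha>1 \<cdot>\<^sub>m ((uR \<otimes>\<^sub>m 1\<^sub>m n) * N_S E) @\<^sub>c - (inverse \<alpha>1 \<cdot>\<^sub>m ((uI \<otimes>\<^sub>m 1\<^sub>m n) * N_SK E)) @\<^sub>c
      inverse \<alpha>2 \<cdot>\<^sub>m ((1\<^sub>m n \<otimes>\<^sub>m pR) * Sigma_mat F) @\<^sub>c inverse \<alpha>2 \<cdot>\<^sub>m ((1\<^sub>m n \<otimes>\<^sub>m pI) * Sigma_mat F))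
     @\<^sub>r
     (inverse \<alpha>1 \<cdot>\<^sub>m ((uI \<otimes>\<^sub>m 1\<^sub>m n) * N_S E) @\<^sub>c inverse \<alpha>1 \<cdot>\<^sub>m ((uR \<otimes>\<^sub>m 1\<^sub>m n) * N_SK E) @\<^sub>c
      inverse \<alpha>2 \<cdot>\<^sub>m ((1\<^sub>m n \<otimes>\<^sub>m pI) * Sigma_mat F) @\<^sub>c - (inverse \<alpha>2 \<cdot>\<^sub>m ((1\<^sub>m n \<otimes>\<^sub>m pR) * Sigma_mat F))))"

definition M2_hat :: "nat \<Rightarrow> real \<Rightarrow> real \<Rightarrow> complex mat \<Rightarrow> complex mat \<Rightarrow> complex vec \<Rightarrow> complex vec \<Rightarrow>
    real mat" where
  "M2_hat m \<alpha>3 \<alpha>4 H G u p =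
    (let uR = mat_of_row (map_vec Re u); uI = mat_of_row (map_vec Im u);
         pR = mat_of_row (map_vec Re p); pI = mat_of_row (map_vec Im p) in
     (inverse \<alpha>3 \<cdot>\<^sub>m ((uR \<otimes>\<^sub>m 1\<^sub>m m) * Sigma_mat H) @\<^sub>c - (inverse \<alpha>3 \<cdot>\<^sub>m ((uI \<otimes>\<^sub>m 1\<^sub>m m) * Sigma_mat H)) @\<^sub>c
      inverse \<alpha>4 \<cdot>\<^sub>m ((pR \<otimes>\<^sub>m 1\<^sub>m m) * N_S G) @\<^sub>c - (inverse \<alpha>4 \<cdot>\<^sub>m ((pI \<otimes>\<^sub>m 1\<^sub>m m) * N_SK G)))
     @\<^sub>r
     (inverse \<alpha>3 \<cdot>\<^sub>m ((uI \<otimes>\<^sub>m 1\<^sub>m m) * Sigma_mat H) @\<^sub>c inverse \<alpha>3 \<cdot>\<^sub>m ((uR \<otimes>\<^sub>m 1\<^sub>m m) * Sigma_mat H) @\<^sub>c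
      inverse \<alpha>4 \<cdot>\<^sub>m ((pI \<otimes>\<^sub>m 1\<^sub>m m) * N_S G) @\<^sub>c inverse \<alpha>4 \<cdot>\<^sub>m ((pR \<otimes>\<^sub>m 1\<^sub>m m) * N_SK G)))"

definition M1 :: "nat \<Rightarrow> nat \<Rightarrow> real \<Rightarrow> real \<Rightarrow> complex mat \<Rightarrow> complex mat \<Rightarrow> complex vec \<Rightarrow> complex vec \<Rightarrow>
    real mat" where
  "M1 n m \<alpha>1 \<alpha>2 E F u p = X1_hat n \<alpha>1 \<alpha>2 E F u p @\<^sub>c 0\<^sub>m (2 * n) (m\<^sup>2 + 2 * m * n)"

definition M2 :: "nat \<Rightarrow> nat \<Rightarrow> real \<Rightarrow> real \<Rightarrow> complex mat \<Rightarrow> complex mat \<Rightarrow> complex vec \<Rightarrow> complex vec \<Rightarrow>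
    real mat" where
  "M2 n m \<alpha>3 \<alpha>4 H G u p = 0\<^sub>m (2 * m) (n\<^sup>2 + 2 * m * n) @\<^sub>c M2_hat m \<alpha>3 \<alpha>4 H G u p"

definition I1 :: "nat \<Rightarrow> nat \<Rightarrow> real \<Rightarrow> real mat" where
  "I1 n m \<beta>1 = - (inverse \<beta>1 \<cdot>\<^sub>m 1\<^sub>m (2 * n)) @\<^sub>c 0\<^sub>m (2 * n) (2 * m)"

definition I2 :: "nat \<Rightarrow> nat \<Rightarrow> real \<Rightarrow> real mat" where
  "I2 n m \<beta>2 = 0\<^sub>m (2 * m) (2 * n) @\<^sub>c - (inverse \<beta>2 \<cdot>\<^sub>m 1\<^sub>m (2 * m))"

section \<open>Well-definedness of the chosen matrices\<close>

lemma ex1_J_aux: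
  fixes ps :: "(nat \<times> nat) list" and P :: "real mat \<Rightarrow> bool"
  assumes d: "length ps = d" "distinct ps"
    and rd: "\<And>Z. Z \<in> carrier_mat k k \<Longrightarrow> rd Z = entries_at ps Z"
    and dup: "\<And>Z i j. Z \<in> carrier_mat k k \<Longrightarrow> P Z \<Longrightarrow> i < k \<Longrightarrow> j < k \<Longrightarrow> Z $$ (i, j) = s i j * Z $$ (t i j)"
    and tps: "\<And>i j. i < k \<Longrightarrow> j < k \<Longrightarrow> t i j \<in> set ps \<or> s i j = 0"
    and surj: "\<And>c. c < d \<Longrightarrow> \<exists>Z \<in> carrier_mat k k. P Z \<and> entries_at ps Z = unit_vec d c"
  shows "\<exists>!J. J \<in> carrier_mat (k * k) d \<and> (\<forall>Z \<in> carrier_mat k k. P Z \<longrightarrow> vec_cols Z = J *\<^sub>v rd Z)"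
proof -
  have dimv: "entries_at ps Z \<in> carrier_vec d" for Z :: "real mat"
    using d(1) by (intro carrier_vecI) (simp add: entries_at_def)
  define J where "J = mat (k * k) d
    (\<lambda>(a, c). if ps ! c = t (a mod k) (a div k) then s (a mod k) (a div k) else 0)"
  have J: "J \<in> carrier_mat (k * k) d" by (simp add: J_def)
  have JZ: "vec_cols Z = J *\<^sub>v entries_at ps Z" if Zc: "Z \<in> carrier_mat k k" and PZ: "P Z" for Z
  proof (rule eq_vecI)
    show "dim_vec (vec_cols Z) = dim_vec (J *\<^sub>v entries_at ps Z)"
      using Zc J by (auto simp: vec_cols_def)
    fix a assume "a < dim_vec (J *\<^sub>v entries_at ps Z)"
    then have a: "a < k * k" using J by simp
    then have k0: "k > 0" by (cases k) auto
    let ?i = "a mod k" and ?j = "a div k"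
    have ij: "?i < k" "?j < k" using a k0 by (auto simp: less_mult_imp_div_less)
    have "(J *\<^sub>v entries_at ps Z) $ a = (\<Sum>c = 0..<d. J $$ (a, c) * entries_at ps Z $ c)"
      using a J dimv[of Z] by (simp add: scalar_prod_def)
    also have "\<dots> = (\<Sum>c = 0..<d. if ps ! c = t ?i ?j then s ?i ?j * Z $$ (t ?i ?j) else 0)"
      by (rule sum.cong) (use a d in \<open>simp_all add: J_def entries_at_def vec_of_list_index\<close>)
    also have "\<dots> = s ?i ?j * Z $$ (t ?i ?j)"
    proof (cases "t ?i ?j \<in> set ps")
      case True
      then obtain c0 where c0: "c0 < d" "ps ! c0 = t ?i ?j" using d by (auto simp: in_set_conv_nth)
      have "(ps ! c = t ?i ?j) = (c = c0)" if "c \<in> {0..<d}" for c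
        unfolding c0(2)[symmetric] using that c0(1) d by (simp add: nth_eq_iff_index_eq)
      then have "(\<Sum>c = 0..<d. if ps ! c = t ?i ?j then s ?i ?j * Z $$ (t ?i ?j) else 0)
          = (\<Sum>c = 0..<d. if c = c0 then s ?i ?j * Z $$ (t ?i ?j) else 0)"
        by (intro sum.cong) simp_all
      then show ?thesis using c0(1) by simp
    next
      case False
      then have "s ?i ?j = 0" using tps[OF ij] by blast
      then show ?thesis by simp
    qed
    also have "\<dots> = Z $$ (?i, ?j)" using dup[OF Zc PZ ij] by simp
    also have "\<dots> = vec_cols Z $ a" using a Zc by (simp add: vec_cols_def)
    finally show "vec_cols Z $ a = (J *\<^sub>v entries_at ps Z) $ a" by simp
  qed
  show ?thesis
  proof (rule ex1I[of _ J])
    show "J \<in> carrier_mat (k * k) d \<and> (\<forall>Z \<in> carrier_mat k k. P Z \<longrightarrow> vec_cols Z = J *\<^sub>v rd Z)"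
      using J JZ rd by simp
    fix K assume K: "K \<in> carrier_mat (k * k) d \<and> (\<forall>Z \<in> carrier_mat k k. P Z \<longrightarrow> vec_cols Z = K *\<^sub>v rd Z)"
    show "K = J"
    proof (rule mat_col_eqI)
      show "dim_row K = dim_row J" "dim_col K = dim_col J" using K J by auto
      fix c assume "c < dim_col J"
      then have c: "c < d" using J by simp
      then obtain Z where Z: "Z \<in> carrier_mat k k" "P Z" "entries_at ps Z = unit_vec d c" using surj by blast
      have "K *\<^sub>v rd Z = J *\<^sub>v rd Z" using K Z(1,2) JZ[OF Z(1,2)] rd[OF Z(1)] by simp
      then have "K *\<^sub>v unit_vec d c = J *\<^sub>v unit_vec d c" unfolding rd[OF Z(1)] Z(3) .
      moreover have "A *\<^sub>v unit_vec d c = col A c" if "A \<in> carrier_mat (k * k) d" for A :: "real mat"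
        using that c by (intro eq_vecI) simp_all
      ultimately show "col K c = col J c" using K J by simp
    qed
  qed
qed

lemma set_lower_pairs: "set (lower_pairs k) = {(i, j). j \<le> i \<and> i < k}"
  unfolding lower_pairs_def by (force simp: image_iff)

lemma set_strict_lower_pairs: "set (strict_lower_pairs k) = {(i, j). j < i \<and> i < k}"
  unfolding strict_lower_pairs_def by (force simp: image_iff)

lemma distinct_lower_pairs: "distinct (lower_pairs k)"
proof -
  have "distinct (concat (map (\<lambda>j. map (\<lambda>i. (i, j)) [j..<k]) [0..<n]))" for n
    by (induction n) (auto simp: distinct_map inj_on_def)
  then show ?thesis by (simp add: lower_pairs_def)
qed

lemma distinct_strict_lower_pairs: "distinct (strict_lower_pairs k)"
proof -
  have "distinct (concat (map (\<lambda>j. map (\<lambda>i. (i, j)) [Suc j..<k]) [0..<n]))" for n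
    by (induction n) (auto simp: distinct_map inj_on_def)
  then show ?thesis by (simp add: strict_lower_pairs_def)
qed

lemma length_lower_prefix:
  "n \<le> k \<Longrightarrow> 2 * length (concat (map (\<lambda>j. map (\<lambda>i. (i, j)) [j..<k]) [0..<n])) = (2 * k + 1 - n) * n"
proof (induction n)
  case (Suc n)
  then obtain e where "k = Suc n + e" using le_Suc_ex by blast
  with Suc show ?case by (simp add: algebra_simps)
qed simp

lemma length_strict_lower_prefix:
  "n \<le> k \<Longrightarrow> 2 * length (concat (map (\<lambda>j. map (\<lambda>i. (i, j)) [Suc j..<k]) [0..<n])) = (2 * k - 1 - n) * n"
proof (induction n)
  case (Suc n)
  then obtain e where "k = Suc n + e" using le_Suc_ex by blast
  with Suc show ?case by (simp add: algebra_simps)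
qed simp

lemma length_lower_pairs: "length (lower_pairs k) = k * (k + 1) div 2"
  using length_lower_prefix[of k k] by (simp add: lower_pairs_def mult.commute)

lemma length_strict_lower_pairs: "length (strict_lower_pairs k) = k * (k - 1) div 2"
proof -
  have "2 * k - 1 - k = k - 1" by simp
  then show ?thesis
    using length_strict_lower_prefix[of k k] by (simp add: strict_lower_pairs_def mult.commute)
qed

lemma lower_pairs_diag:
  assumes "i < k"
  shows "lower_pairs k ! ((2 * k + 1 - i) * i div 2) = (i, i)"
proof -
  let ?f = "\<lambda>j. map (\<lambda>i. (i, j)) [j..<k]"
  have "[0..<k] = [0..<i] @ [i..<k]"
    using assms upt_add_eq_append[of 0 i "k - i"] by simp
  then have "lower_pairs k = concat (map ?f [0..<i]) @ concat (map ?f [i..<k])"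
    by (simp add: lower_pairs_def)
  also have "concat (map ?f [i..<k]) = (i, i) # (map (\<lambda>a. (a, i)) [Suc i..<k] @ concat (map ?f [Suc i..<k]))"
    using assms by (simp add: upt_conv_Cons)
  finally have *: "lower_pairs k = concat (map ?f [0..<i]) @
      (i, i) # (map (\<lambda>a. (a, i)) [Suc i..<k] @ concat (map ?f [Suc i..<k]))" .
  have len: "length (concat (map ?f [0..<i])) = (2 * k + 1 - i) * i div 2"
    using length_lower_prefix[of i k, symmetric] assms by (simp del: length_concat)
  show ?thesis unfolding * by (simp only: len [symmetric] nth_append_length)
qed

lemma ex1_J_S:
  "\<exists>!J. J \<in> carrier_mat (k * k) (k * (k + 1) div 2) \<and>
     (\<forall>Z \<in> carrier_mat k k. transpose_mat Z = Z \<longrightarrow> vec_cols Z = J *\<^sub>v vec_S Z)"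
proof -
  let ?ps = "lower_pairs k" and ?d = "k * (k + 1) div 2"
  let ?s = "\<lambda>i j :: nat. 1 :: real"
  have len: "length ?ps = ?d" by (rule length_lower_pairs)
  show ?thesis
  proof (rule ex1_J_aux[where ps = ?ps and s = ?s and t = "\<lambda>i j. (max i j, min i j)"])
    show "length ?ps = ?d" by (rule len)
    show "distinct ?ps" by (rule distinct_lower_pairs)
    show "vec_S Z = entries_at ?ps Z" if "Z \<in> carrier_mat k k" for Z
      unfolding vec_S_def carrier_matD(1)[OF that] ..
    show "(max i j, min i j) \<in> set ?ps \<or> ?s i j = 0" if "i < k" "j < k" for i j
      using that by (cases i j rule: linorder_cases) (simp_all add: set_lower_pairs)
    show "Z $$ (i, j) = ?s i j * Z $$ (max i j, min i j)"
      if Z: "Z \<in> carrier_mat k k" and ZT: "transpose_mat Z = Z" and ij: "i < k" "j < k" for Z i j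
    proof -
      have "transpose_mat Z $$ (i, j) = Z $$ (j, i)" using Z ij by simp
      then have *: "Z $$ (j, i) = Z $$ (i, j)" unfolding ZT using Z ij by simp
      show ?thesis
      proof (cases i j rule: linorder_cases)
        case less
        then show ?thesis using * by simp
      next
        case equal
        then show ?thesis using * by simp
      next
        case greater
        then show ?thesis by simp
      qed
    qed
    fix c assume c: "c < ?d"
    obtain a b where ab: "?ps ! c = (a, b)" by (meson surj_pair)
    define Z where "Z = mat k k (\<lambda>(i, j). if (max i j, min i j) = (a, b) then ?s i j else 0)"
    have Zc: "Z \<in> carrier_mat k k" by (simp add: Z_def)
    have ent: "entries_at ?ps Z = unit_vec ?d c"
    proof (rule eq_vecI)
      fix l assume "l < dim_vec (unit_vec ?d c :: real vec)"
      then have l: "l < ?d" by simp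
      obtain i j where ij: "?ps ! l = (i, j)" by (meson surj_pair)
      have "?ps ! l \<in> set ?ps" using l len by (intro nth_mem) simp
      then have "j \<le> i" "i < k" unfolding ij set_lower_pairs by auto
      then have "entries_at ?ps Z $ l = (if (i, j) = (a, b) then 1 else 0)"
        using l len ij by (simp add: entries_at_def vec_of_list_index Z_def max_def min_def)
      also have "(i, j) = (a, b) \<longleftrightarrow> l = c"
        unfolding ij[symmetric] ab[symmetric] using l c len distinct_lower_pairs
        by (intro nth_eq_iff_index_eq) simp_all
      also have "(if l = c then 1 else 0) = (unit_vec ?d c :: real vec) $ l"
        using l c by simp
      finally show "entries_at ?ps Z $ l = unit_vec ?d c $ l" .
    qed (simp add: entries_at_def len)
    have "transpose_mat Z = Z"
    proof (rule eq_matI)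
      fix i j assume "i < dim_row Z" "j < dim_col Z"
      then have "i < k" "j < k" using Zc by simp_all
      then show "transpose_mat Z $$ (i, j) = Z $$ (i, j)"
        unfolding Z_def by (cases i j rule: linorder_cases) simp_all
    qed (use Zc in simp_all)
    with ent show "\<exists>Z \<in> carrier_mat k k. transpose_mat Z = Z \<and> entries_at ?ps Z = (unit_vec ?d c :: real vec)"
      by (intro bexI[OF _ Zc] conjI)
  qed
qed

lemma ex1_J_SK:
  "\<exists>!J. J \<in> carrier_mat (k * k) (k * (k - 1) div 2) \<and>
     (\<forall>Z \<in> carrier_mat k k. transpose_mat Z = - Z \<longrightarrow> vec_cols Z = J *\<^sub>v vec_SK Z)"
proof -
  let ?ps = "strict_lower_pairs k" and ?d = "k * (k - 1) div 2"
  let ?s = "\<lambda>i j :: nat. if j < i then 1 else if i < j then - 1 else (0 :: real)"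
  have len: "length ?ps = ?d" by (rule length_strict_lower_pairs)
  show ?thesis
  proof (rule ex1_J_aux[where ps = ?ps and s = ?s and t = "\<lambda>i j. (max i j, min i j)"])
    show "length ?ps = ?d" by (rule len)
    show "distinct ?ps" by (rule distinct_strict_lower_pairs)
    show "vec_SK Z = entries_at ?ps Z" if "Z \<in> carrier_mat k k" for Z
      unfolding vec_SK_def carrier_matD(1)[OF that] ..
    show "(max i j, min i j) \<in> set ?ps \<or> ?s i j = 0" if "i < k" "j < k" for i j
      using that by (cases i j rule: linorder_cases) (simp_all add: set_strict_lower_pairs)
    show "Z $$ (i, j) = ?s i j * Z $$ (max i j, min i j)"
      if Z: "Z \<in> carrier_mat k k" and ZT: "transpose_mat Z = - Z" and ij: "i < k" "j < k" for Z i j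
    proof -
      have "transpose_mat Z $$ (i, j) = Z $$ (j, i)" using Z ij by simp
      then have *: "Z $$ (j, i) = - Z $$ (i, j)" unfolding ZT using Z ij by simp
      show ?thesis
      proof (cases i j rule: linorder_cases)
        case less
        then show ?thesis using * by simp
      next
        case equal
        then show ?thesis using * by simp
      next
        case greater
        then show ?thesis by simp
      qed
    qed
    fix c assume c: "c < ?d"
    obtain a b where ab: "?ps ! c = (a, b)" by (meson surj_pair)
    define Z where "Z = mat k k (\<lambda>(i, j). if (max i j, min i j) = (a, b) then ?s i j else 0)"
    have Zc: "Z \<in> carrier_mat k k" by (simp add: Z_def)
    have ent: "entries_at ?ps Z = unit_vec ?d c"
    proof (rule eq_vecI)
      fix l assume "l < dim_vec (unit_vec ?d c :: real vec)"
      then have l: "l < ?d" by simp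
      obtain i j where ij: "?ps ! l = (i, j)" by (meson surj_pair)
      have "?ps ! l \<in> set ?ps" using l len by (intro nth_mem) simp
      then have "j < i" "i < k" unfolding ij set_strict_lower_pairs by auto
      then have "entries_at ?ps Z $ l = (if (i, j) = (a, b) then 1 else 0)"
        using l len ij by (simp add: entries_at_def vec_of_list_index Z_def max_def min_def)
      also have "(i, j) = (a, b) \<longleftrightarrow> l = c"
        unfolding ij[symmetric] ab[symmetric] using l c len distinct_strict_lower_pairs
        by (intro nth_eq_iff_index_eq) simp_all
      also have "(if l = c then 1 else 0) = (unit_vec ?d c :: real vec) $ l"
        using l c by simp
      finally show "entries_at ?ps Z $ l = unit_vec ?d c $ l" .
    qed (simp add: entries_at_def len)
    have "transpose_mat Z = - Z"
    proof (rule eq_matI)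
      fix i j assume "i < dim_row (- Z)" "j < dim_col (- Z)"
      then have "i < k" "j < k" using Zc by simp_all
      then show "transpose_mat Z $$ (i, j) = (- Z) $$ (i, j)"
        unfolding Z_def by (cases i j rule: linorder_cases) simp_all
    qed (use Zc in simp_all)
    with ent show "\<exists>Z \<in> carrier_mat k k. transpose_mat Z = - Z \<and> entries_at ?ps Z = (unit_vec ?d c :: real vec)"
      by (intro bexI[OF _ Zc] conjI)
  qed
qed

end

theory Submission
  imports Defs
begin

text \<open>The scaled real coordinates of a masked perturbation form a vector whose Euclidean norm is
  the weighted norm of the perturbation: the factors \<open>sqrt 2\<close> account for the off-diagonal entries
  of a Hermitian matrix being counted twice in the Frobenius norm. In these coordinates the perturbed
  saddle point equation reads \<open>K y = b\<close>. Conversely, every solution \<open>y\<close> yields a feasible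
  masked perturbation of norm at most the norm of \<open>y\<close>, since coordinates outside the sparsity
  pattern are annihilated by \<open>K\<close>. So the backward error is the norm of the least-norm solution
  of \<open>K y = b\<close>. The blocks \<open>- inverse \<beta> I\<close> give \<open>K\<close> full row rank, which makes
  \<open>K K\<^sup>T\<close> invertible.\<close>

section \<open>Least-norm solutions\<close>

text \<open>\<open>J_S\<close> and \<open>J_SK\<close> are given by definite descriptions, so they
  are known only through their action on symmetric and skew-symmetric matrices. No entry of
  \<open>N_S\<close> or \<open>N_SK\<close> is therefore computed: each block is followed as a map
  applied to a coordinate vector. Coordinates and matrices are tied together only through images, as
  in \<open>N_S E *\<^sub>v a = \<alpha>1 \<cdot>\<^sub>v vec_cols (map_mat Re Y)\<close>. A
  relation of this kind, unlike a bijection, tolerates the columns of \<open>K\<close> that belong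
  to positions outside the pattern. Symmetric coordinates carry the real part of a Hermitian block,
  skew-symmetric ones its imaginary part. The closed formula itself is orthogonality: its vector
  lies in the range of the transpose of \<open>K\<close>, which is orthogonal to the kernel of
  \<open>K\<close>.\<close>

lemma inv_mat_inverse:
  fixes A :: "'a :: field mat"
  assumes A: "A \<in> carrier_mat n n" and det: "det A \<noteq> 0"
  shows "A * inv_mat A = 1\<^sub>m n" "inv_mat A * A = 1\<^sub>m n" "inv_mat A \<in> carrier_mat n n"
    "invertible_mat A"
proof -
  have "A \<in> Units (ring_mat TYPE('a) n ())"
    using det_non_zero_imp_unit[OF A det] .
  \<comment> \<open>\<open>mat_inverse\<close> yields \<open>None\<close> only for matrices that are
    not units, so the \<open>the\<close> inside \<open>inv_mat\<close> meets a genuine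
    value.\<close>
  then obtain B where "mat_inverse A = Some B"
    using mat_inverse(1)[OF A, where b = "()"] by (cases "mat_inverse A") auto
  then show *: "A * inv_mat A = 1\<^sub>m n" "inv_mat A * A = 1\<^sub>m n" "inv_mat A \<in> carrier_mat n n"
    using mat_inverse(2)[OF A] by (simp_all add: inv_mat_def)
  then show "invertible_mat A"
    using A unfolding invertible_mat_def inverts_mat_def by auto
qed

lemma norm2_nonneg: "0 \<le> norm2 v"
  by (simp add: norm2_def sum_nonneg)

lemma norm2_power2: "(norm2 v)\<^sup>2 = (\<Sum>i<dim_vec v. (norm (v $ i))\<^sup>2)"
  by (simp add: norm2_def sum_nonneg)

lemma norm2_sq_real: "(norm2 (v :: real vec))\<^sup>2 = v \<bullet> v"
  unfolding norm2_power2 by (simp add: scalar_prod_def power2_eq_square atLeast0LessThan)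

lemma norm2_eq_0_real:
  assumes "(v :: real vec) \<in> carrier_vec n" "norm2 v = 0"
  shows "v = 0\<^sub>v n"
proof -
  have "(\<Sum>i<dim_vec v. (norm (v $ i))\<^sup>2) = 0"
    using norm2_power2[of v] assms(2) by simp
  then have "v $ i = 0" if "i < dim_vec v" for i
    using that by (subst (asm) sum_nonneg_eq_0_iff) auto
  then show ?thesis using assms(1) by (intro eq_vecI) auto
qed

lemma norm2_sq_append:
  "(norm2 (v @\<^sub>v w))\<^sup>2 = (norm2 v)\<^sup>2 + (norm2 (w :: real vec))\<^sup>2"
  unfolding norm2_sq_real
  by (rule scalar_prod_append) (auto intro: carrier_vecI)

lemma norm2_sq_smult: "(norm2 (c \<cdot>\<^sub>v v))\<^sup>2 = c\<^sup>2 * (norm2 (v :: real vec))\<^sup>2"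
  by (simp add: norm2_power2 sum_distrib_left power_mult_distrib)

lemma norm2_complex_parts:
  "(norm2 z)\<^sup>2 = (norm2 (map_vec Re z))\<^sup>2 + (norm2 (map_vec Im z))\<^sup>2"
  by (simp add: norm2_power2 cmod_power2 sum.distrib)

lemma transpose_mult_scalar_prod:
  fixes K :: "real mat"
  assumes K: "K \<in> carrier_mat r c" and v: "v \<in> carrier_vec r" and w: "w \<in> carrier_vec c"
  shows "(transpose_mat K *\<^sub>v v) \<bullet> w = v \<bullet> (K *\<^sub>v w)"
  using transpose_vec_mult_scalar[OF K w v] mult_mat_vec_carrier[OF K w] v
  by (simp add: comm_scalar_prod[of _ r])

text \<open>If \<open>v\<close> is killed by the Gram matrix, then the squared norm of
  \<open>transpose_mat K *\<^sub>v v\<close> is \<open>v\<close> times that zero vector, so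
  \<open>v\<close> is already killed by the transpose. Surjectivity writes \<open>v\<close> as
  \<open>K *\<^sub>v y\<close>, and moving \<open>K\<close> across the scalar product gives
  \<open>v\<close> norm 0.\<close>

lemma det_mult_transpose:
  fixes K :: "real mat"
  assumes K: "K \<in> carrier_mat r c"
    and surj: "\<And>v. v \<in> carrier_vec r \<Longrightarrow> \<exists>y \<in> carrier_vec c. K *\<^sub>v y = v"
  shows "det (K * transpose_mat K) \<noteq> 0"
proof
  have T: "transpose_mat K \<in> carrier_mat c r" using K by simp
  have KK: "K * transpose_mat K \<in> carrier_mat r r" using K by simp
  assume "det (K * transpose_mat K) = 0"
  then obtain v where v: "v \<in> carrier_vec r" "v \<noteq> 0\<^sub>v r" "(K * transpose_mat K) *\<^sub>v v = 0\<^sub>v r"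
    using det_0_iff_vec_prod_zero_field[OF KK] by auto
  have tv: "transpose_mat K *\<^sub>v v \<in> carrier_vec c" using T v(1) by simp
  have "(norm2 (transpose_mat K *\<^sub>v v))\<^sup>2 = v \<bullet> (K *\<^sub>v (transpose_mat K *\<^sub>v v))"
    unfolding norm2_sq_real by (rule transpose_mult_scalar_prod[OF K v(1) tv])
  also have "\<dots> = 0" using v assoc_mult_mat_vec[OF K T v(1)] by simp
  finally have Kv: "transpose_mat K *\<^sub>v v = 0\<^sub>v c" using norm2_eq_0_real[OF tv] by simp
  obtain y where y: "y \<in> carrier_vec c" "K *\<^sub>v y = v" using surj[OF v(1)] by blast
  have "(norm2 v)\<^sup>2 = (transpose_mat K *\<^sub>v v) \<bullet> y"
    unfolding norm2_sq_real transpose_mult_scalar_prod[OF K v(1) y(1)] y(2) ..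
  also have "\<dots> = 0" unfolding Kv using y(1) by simp
  finally show False using norm2_eq_0_real[OF v(1)] v(2) by simp
qed

text \<open>\<open>y0\<close> lies in the range of the transpose and two solutions differ by a
  kernel vector, so \<open>y - y0\<close> is orthogonal to \<open>y0\<close>; Pythagoras gives
  minimality.\<close>

lemma least_norm_solution:
  fixes K :: "real mat"
  assumes K: "K \<in> carrier_mat r c" and det: "det (K * transpose_mat K) \<noteq> 0"
    and b: "b \<in> carrier_vec r"
  defines "y0 \<equiv> (transpose_mat K * inv_mat (K * transpose_mat K)) *\<^sub>v b"
  shows "y0 \<in> carrier_vec c" "K *\<^sub>v y0 = b"
    and "\<And>y. y \<in> carrier_vec c \<Longrightarrow> K *\<^sub>v y = b \<Longrightarrow> norm2 y0 \<le> norm2 y"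
proof -
  let ?W = "inv_mat (K * transpose_mat K)"
  have T: "transpose_mat K \<in> carrier_mat c r" using K by simp
  have KK: "K * transpose_mat K \<in> carrier_mat r r" using K by simp
  note W = inv_mat_inverse[OF KK det]
  define w where "w = ?W *\<^sub>v b"
  have w: "w \<in> carrier_vec r" using W(3) b by (simp add: w_def)
  have y0: "y0 = transpose_mat K *\<^sub>v w"
    unfolding y0_def w_def by (rule assoc_mult_mat_vec[OF T W(3) b])
  show y0c: "y0 \<in> carrier_vec c" unfolding y0 using T w by simp
  have "K *\<^sub>v y0 = (K * transpose_mat K) *\<^sub>v w"
    unfolding y0 by (rule assoc_mult_mat_vec[OF K T w, symmetric])
  also have "\<dots> = (K * transpose_mat K * ?W) *\<^sub>v b"
    unfolding w_def by (rule assoc_mult_mat_vec[OF KK W(3) b, symmetric])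
  also have "\<dots> = b" using W(1) b by simp
  finally show Ky0: "K *\<^sub>v y0 = b" .
  fix y assume y: "y \<in> carrier_vec c" "K *\<^sub>v y = b"
  \<comment> \<open>Writing \<open>y0\<close> as the transpose applied to \<open>w\<close>, both
    sides become \<open>w \<bullet> b\<close>.\<close>
  have "y0 \<bullet> y = y0 \<bullet> y0"
    using transpose_mult_scalar_prod[OF K w y(1)] transpose_mult_scalar_prod[OF K w y0c]
    by (simp add: y(2) Ky0 flip: y0)
  moreover have "y \<bullet> y0 = y0 \<bullet> y" by (rule comm_scalar_prod[OF y(1) y0c])
  ultimately have "(norm2 (y - y0))\<^sup>2 = (norm2 y)\<^sup>2 - (norm2 y0)\<^sup>2"
    using y(1) y0c unfolding norm2_sq_real
    by (simp add: minus_scalar_prod_distrib[of _ c] scalar_prod_minus_distrib[of _ c])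
  then have "(norm2 y0)\<^sup>2 \<le> (norm2 y)\<^sup>2" by (metis diff_ge_0_iff_ge zero_le_power2)
  then show "norm2 y0 \<le> norm2 y" using norm2_nonneg by (rule power2_le_imp_le)
qed

section \<open>Vectorization\<close>

lemma append_cols_carrier:
  "A \<in> carrier_mat r c1 \<Longrightarrow> B \<in> carrier_mat r c2 \<Longrightarrow> A @\<^sub>c B \<in> carrier_mat r (c1 + c2)"
  by (auto simp: append_cols_def)

text \<open>\<open>@\<^sub>c\<close> is a four-block matrix whose lower blocks have no rows, so the
  block product rule applies and the lower part of the result is a vector of dimension 0.\<close>

lemma append_cols_mult_vec:
  fixes A B :: "'a :: comm_ring_1 mat"
  assumes "A \<in> carrier_mat r c1" "B \<in> carrier_mat r c2" "x \<in> carrier_vec c1" "y \<in> carrier_vec c2"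
  shows "(A @\<^sub>c B) *\<^sub>v (x @\<^sub>v y) = A *\<^sub>v x + B *\<^sub>v y"
proof -
  have "(A @\<^sub>c B) *\<^sub>v (x @\<^sub>v y) =
      (A *\<^sub>v x + B *\<^sub>v y) @\<^sub>v (0\<^sub>m 0 c1 *\<^sub>v x + 0\<^sub>m 0 c2 *\<^sub>v y)"
    using four_block_mat_mult_vec[of A r c1 B c2 "0\<^sub>m 0 c1" 0 "0\<^sub>m 0 c2" x y] assms
    by (auto simp: append_cols_def)
  then show ?thesis using assms by (auto intro!: eq_vecI)
qed

lemma append_vec_assoc: "(u @\<^sub>v v) @\<^sub>v w = u @\<^sub>v (v @\<^sub>v w)"
  by (rule eq_vecI) auto

lemma vec_cols_carrier: "A \<in> carrier_mat r c \<Longrightarrow> vec_cols A \<in> carrier_vec (r * c)"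
  by (auto simp: vec_cols_def)

text \<open>Position \<open>l = j * r + i\<close> of a column-stacked matrix with \<open>r\<close>
  rows belongs to column \<open>l div r\<close> and row \<open>l mod r\<close>. Sums over stacked
  entries become double sums by this change of index.\<close>

lemma sum_div_mod:
  fixes g :: "nat \<Rightarrow> nat \<Rightarrow> 'a :: comm_monoid_add"
  shows "(\<Sum>l<c * r. g (l div r) (l mod r)) = (\<Sum>j<c. \<Sum>i<r. g j i)"
proof -
  have "(\<Sum>i<r. g j i) = (\<Sum>l = j * r..<j * r + r. g (l div r) (l mod r))" for j
  proof -
    have "(\<Sum>i<r. g j i) = (\<Sum>i = 0..<r. g ((i + j * r) div r) ((i + j * r) mod r))"
      by (rule sum.cong) (auto simp: atLeast0LessThan)
    also have "\<dots> = (\<Sum>l = j * r..<j * r + r. g (l div r) (l mod r))"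
      using sum.shift_bounds_nat_ivl[of "\<lambda>l. g (l div r) (l mod r)" 0 "j * r" r]
      by (simp add: add.commute)
    finally show ?thesis .
  qed
  then show ?thesis by (simp add: sum.nat_group[symmetric])
qed

lemma norm_F_power2: "(norm_F A)\<^sup>2 = (\<Sum>i<dim_row A. \<Sum>j<dim_col A. (norm (A $$ (i, j)))\<^sup>2)"
  by (simp add: norm_F_def sum_nonneg)

lemma norm2_vec_cols: "norm2 (vec_cols A) = norm_F A"
proof -
  have "(\<Sum>l<dim_row A * dim_col A. (norm (vec_cols A $ l))\<^sup>2) =
      (\<Sum>l<dim_col A * dim_row A. (norm (A $$ (l mod dim_row A, l div dim_row A)))\<^sup>2)"
    by (rule sum.cong) (auto simp: vec_cols_def mult.commute)
  also have "\<dots> = (\<Sum>j<dim_col A. \<Sum>i<dim_row A. (norm (A $$ (i, j)))\<^sup>2)"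
    by (rule sum_div_mod)
  finally show ?thesis
    unfolding norm2_def norm_F_def
    by (subst sum.swap) (simp add: vec_cols_def)
qed

lemma norm_F_complex_parts:
  "(norm_F Z)\<^sup>2 = (norm_F (map_mat Re Z))\<^sup>2 + (norm_F (map_mat Im Z))\<^sup>2"
  by (simp add: norm_F_power2 cmod_power2 sum.distrib)

section \<open>Kronecker products acting on stacked matrices\<close>

lemma kronecker_carrier:
  "A \<in> carrier_mat a b \<Longrightarrow> B \<in> carrier_mat c d \<Longrightarrow> A \<otimes>\<^sub>m B \<in> carrier_mat (a * c) (b * d)"
  by (auto simp: kronecker_def)

text \<open>The identity vec(A Z B) = (B^T kron A) vec(Z) with A the identity and B the single
  column \<open>x\<close>.\<close>

lemma kronecker_row_one_mult_vec_cols: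
  fixes x :: "'a :: comm_ring_1 vec"
  assumes Z: "Z \<in> carrier_mat r c" and x: "x \<in> carrier_vec c"
  shows "(mat_of_row x \<otimes>\<^sub>m 1\<^sub>m r) *\<^sub>v vec_cols Z = Z *\<^sub>v x"
proof (rule eq_vecI)
  show "dim_vec ((mat_of_row x \<otimes>\<^sub>m 1\<^sub>m r) *\<^sub>v vec_cols Z) = dim_vec (Z *\<^sub>v x)"
    using Z by (simp add: kronecker_def)
  fix i assume "i < dim_vec (Z *\<^sub>v x)"
  then have i: "i < r" using Z by simp
  have "((mat_of_row x \<otimes>\<^sub>m 1\<^sub>m r) *\<^sub>v vec_cols Z) $ i =
      (\<Sum>l<c * r. x $ (l div r) * (if i = l mod r then 1 else 0) * Z $$ (l mod r, l div r))"
    using Z x i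
    by (auto simp: kronecker_def scalar_prod_def vec_cols_def atLeast0LessThan less_mult_imp_div_less
        mult.commute intro!: sum.cong)
  also have "\<dots> = (\<Sum>j<c. \<Sum>k<r. x $ j * (if i = k then 1 else 0) * Z $$ (k, j))"
    by (rule sum_div_mod)
  also have "\<dots> = (\<Sum>j<c. Z $$ (i, j) * x $ j)"
    using i by (intro sum.cong) (simp_all add: if_distrib if_distribR mult.commute cong: if_cong)
  also have "\<dots> = (Z *\<^sub>v x) $ i"
    using Z x i by (simp add: scalar_prod_def atLeast0LessThan)
  finally show "((mat_of_row x \<otimes>\<^sub>m 1\<^sub>m r) *\<^sub>v vec_cols Z) $ i = (Z *\<^sub>v x) $ i" .
qed

text \<open>The same identity with A the single row \<open>x\<close> and B the identity: stacking
  the row x^T Z gives the column Z^T x. This is how the transposed block of the saddle point matrix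
  is reached from coordinates of the block itself.\<close>

lemma kronecker_one_row_mult_vec_cols:
  fixes x :: "'a :: comm_ring_1 vec"
  assumes Z: "Z \<in> carrier_mat r c" and x: "x \<in> carrier_vec r"
  shows "(1\<^sub>m c \<otimes>\<^sub>m mat_of_row x) *\<^sub>v vec_cols Z = transpose_mat Z *\<^sub>v x"
proof (rule eq_vecI)
  show "dim_vec ((1\<^sub>m c \<otimes>\<^sub>m mat_of_row x) *\<^sub>v vec_cols Z) = dim_vec (transpose_mat Z *\<^sub>v x)"
    using Z by (simp add: kronecker_def)
  fix j assume "j < dim_vec (transpose_mat Z *\<^sub>v x)"
  then have j: "j < c" using Z by simp
  have "((1\<^sub>m c \<otimes>\<^sub>m mat_of_row x) *\<^sub>v vec_cols Z) $ j =
      (\<Sum>l<c * r. (if j = l div r then 1 else 0) * x $ (l mod r) * Z $$ (l mod r, l div r))"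
  proof -
    \<comment> \<open>For \<open>r = 0\<close> the index range is empty, so the bound needs no
      positivity assumption.\<close>
    have "l mod r < r" if "l < c * r" for l using that by (cases r) auto
    then show ?thesis
      using Z x j
      by (auto simp: kronecker_def scalar_prod_def vec_cols_def atLeast0LessThan less_mult_imp_div_less
          mult.commute intro!: sum.cong)
  qed
  also have "\<dots> = (\<Sum>k<c. \<Sum>i<r. (if j = k then 1 else 0) * x $ i * Z $$ (i, k))"
    by (rule sum_div_mod)
  also have "\<dots> = (\<Sum>k<c. if j = k then \<Sum>i<r. x $ i * Z $$ (i, k) else 0)"
    by (intro sum.cong) simp_all
  also have "\<dots> = (\<Sum>i<r. Z $$ (i, j) * x $ i)"
    using j by (simp add: mult.commute)
  also have "\<dots> = (transpose_mat Z *\<^sub>v x) $ j"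
    using Z x j by (simp add: scalar_prod_def atLeast0LessThan)
  finally show "((1\<^sub>m c \<otimes>\<^sub>m mat_of_row x) *\<^sub>v vec_cols Z) $ j = (transpose_mat Z *\<^sub>v x) $ j" .
qed

lemma mat_diag_mult_vec:
  fixes v :: "'a :: comm_ring_1 vec"
  assumes "v \<in> carrier_vec n"
  shows "mat_diag n f *\<^sub>v v = vec n (\<lambda>i. f i * v $ i)"
  using assms
  by (auto simp: mat_diag_def scalar_prod_def if_distrib if_distribR cong: if_cong intro!: eq_vecI)

lemma inv_mat_diag:
  fixes f :: "nat \<Rightarrow> 'a :: field"
  assumes "\<And>i. i < n \<Longrightarrow> f i \<noteq> 0"
  shows "inv_mat (mat_diag n f) = mat_diag n (\<lambda>i. inverse (f i))"
proof -
  let ?A = "mat_diag n f" and ?B = "mat_diag n (\<lambda>i. inverse (f i))"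
  have A: "?A \<in> carrier_mat n n" and B: "?B \<in> carrier_mat n n" by simp_all
  have AB: "?A * ?B = 1\<^sub>m n" unfolding mat_diag_diag by (rule eq_matI) (use assms in \<open>simp_all add: mat_diag_def\<close>)
  then have "det ?A * det ?B = 1" using det_mult[OF A B] by simp
  then have "det ?A \<noteq> 0" by auto
  note inv = inv_mat_inverse[OF A this]
  have "inv_mat ?A * (?A * ?B) = inv_mat ?A * ?A * ?B"
    by (rule assoc_mult_mat[OF inv(3) A B, symmetric])
  then show ?thesis unfolding AB inv(2) using inv(3) B by simp
qed

section \<open>Sparse symmetric and skew-symmetric matrices\<close>

lemma Theta_carrier: "X \<in> carrier_mat r c \<Longrightarrow> Theta X \<in> carrier_mat r c"
  by (auto simp: Theta_def)

lemma Theta_index: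
  "X \<in> carrier_mat r c \<Longrightarrow> i < r \<Longrightarrow> j < c \<Longrightarrow> Theta X $$ (i, j) = (if X $$ (i, j) = 0 then 0 else 1)"
  by (auto simp: Theta_def)

lemma Theta_symmetricD:
  assumes "X \<in> carrier_mat k k" "transpose_mat (Theta X) = (Theta X :: real mat)"
    "i < k" "j < k" "X $$ (i, j) = 0"
  shows "X $$ (j, i) = 0"
proof -
  have "transpose_mat (Theta X :: real mat) $$ (j, i) = Theta X $$ (i, j)"
    using assms(1,3,4) by (simp add: Theta_def)
  then have "(Theta X :: real mat) $$ (j, i) = Theta X $$ (i, j)" unfolding assms(2) .
  then show ?thesis
    using assms(3-5) by (simp add: Theta_index[OF assms(1)] split: if_splits)
qed

lemma hadamard_Theta_eq_iff:
  fixes A :: "'a :: semiring_1 mat"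
  assumes "A \<in> carrier_mat r c" "X \<in> carrier_mat r c"
  shows "A \<odot>\<^sub>m Theta X = A \<longleftrightarrow> (\<forall>i<r. \<forall>j<c. X $$ (i, j) = 0 \<longrightarrow> A $$ (i, j) = 0)" (is "?L \<longleftrightarrow> ?R")
proof
  assume L: ?L
  show ?R
  proof (intro allI impI)
    fix i j assume ij: "i < r" "j < c" "X $$ (i, j) = 0"
    then have "(A \<odot>\<^sub>m Theta X) $$ (i, j) = 0" using assms by (simp add: hadamard_def Theta_def)
    then show "A $$ (i, j) = 0" unfolding L .
  qed
next
  assume ?R
  then show ?L using assms by (auto simp: hadamard_def Theta_def intro!: eq_matI)
qed

lemma hadamard_Theta_idem:
  fixes A :: "'a :: semiring_1 mat"
  assumes "A \<in> carrier_mat r c" "X \<in> carrier_mat r c"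
  shows "A \<odot>\<^sub>m Theta X \<odot>\<^sub>m Theta X = A \<odot>\<^sub>m Theta X"
  using assms by (auto simp: hadamard_def Theta_def intro!: eq_matI)

text \<open>Every off-diagonal position is visited together with its mirror image, the form in which
  the double count of the Frobenius norm can be compared with a sum over one triangle. The induction
  step adds the last row and the last column.\<close>

lemma sum_square:
  fixes h :: "nat \<Rightarrow> nat \<Rightarrow> 'a :: comm_monoid_add"
  shows "(\<Sum>i<k. \<Sum>j<k. h i j) = (\<Sum>i<k. h i i + (\<Sum>j<i. h i j + h j i))"
  by (induction k) (simp_all add: sum.distrib ac_simps)

lemma sum_nth_distinct:
  "distinct xs \<Longrightarrow> (\<Sum>l<length xs. f (xs ! l)) = (\<Sum>x\<in>set xs. f x)"
  by (rule sum.reindex_bij_betw[OF bij_betw_nth]) simp_all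

text \<open>Positions in a list without repetitions can be recovered from its elements. A coordinate
  vector indexed by list positions thus becomes a function on index pairs, from which a matrix can
  be built.\<close>

lemma ex_function_on_nth:
  assumes "distinct xs"
  obtains g where "\<And>l. l < length xs \<Longrightarrow> g (xs ! l) = f l"
proof
  fix l assume "l < length xs"
  then have "(THE k. k < length xs \<and> xs ! k = xs ! l) = l"
    using assms by (intro the_equality) (auto simp: nth_eq_iff_index_eq)
  then show "(\<lambda>x. f (THE k. k < length xs \<and> xs ! k = x)) (xs ! l) = f l" by simp
qed

lemma entries_at_index: "l < length ps \<Longrightarrow> entries_at ps Z $ l = Z $$ (ps ! l)"
  by (simp add: entries_at_def vec_of_list_index)

lemma entries_at_dim: "dim_vec (entries_at ps Z) = length ps"
  by (simp add: entries_at_def)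

section \<open>Coordinates of symmetric and skew-symmetric matrices: the maps \<open>N_S\<close> and
  \<open>N_SK\<close>\<close>

lemma J_S:
  "J_S k \<in> carrier_mat (k * k) (k * (k + 1) div 2)"
  "Z \<in> carrier_mat k k \<Longrightarrow> transpose_mat Z = Z \<Longrightarrow> J_S k *\<^sub>v vec_S Z = vec_cols Z"
  using theI'[OF ex1_J_S[of k]] unfolding J_S_def[symmetric] by simp_all

lemma J_SK:
  "J_SK k \<in> carrier_mat (k * k) (k * (k - 1) div 2)"
  "Z \<in> carrier_mat k k \<Longrightarrow> transpose_mat Z = - Z \<Longrightarrow> J_SK k *\<^sub>v vec_SK Z = vec_cols Z"
  using theI'[OF ex1_J_SK[of k]] unfolding J_SK_def[symmetric] by simp_all

text \<open>The common shape of \<open>N_S\<close> and \<open>N_SK\<close>: divide the coordinates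
  by the weights \<open>w\<close>, apply the pattern \<open>f\<close>, then expand to a full stacked
  matrix by \<open>J\<close>.\<close>

lemma mult_diag_inv_diag:
  fixes J :: "'a :: field mat"
  assumes J: "J \<in> carrier_mat r d" and w: "\<And>l. l < d \<Longrightarrow> w l \<noteq> 0"
  shows "J * mat_diag d f * inv_mat (mat_diag d w) \<in> carrier_mat r d"
    and "v \<in> carrier_vec d \<Longrightarrow>
      (J * mat_diag d f * inv_mat (mat_diag d w)) *\<^sub>v v = J *\<^sub>v vec d (\<lambda>l. f l * (v $ l / w l))"
proof -
  let ?D = "mat_diag d f" and ?W = "mat_diag d (\<lambda>l. inverse (w l))"
  have inv: "inv_mat (mat_diag d w) = ?W" by (rule inv_mat_diag[OF w])
  show "J * ?D * inv_mat (mat_diag d w) \<in> carrier_mat r d"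
    unfolding inv using J by (auto simp: mat_diag_def)
  assume v: "v \<in> carrier_vec d"
  have "(J * ?D * ?W) *\<^sub>v v = (J * ?D) *\<^sub>v (?W *\<^sub>v v)"
    using J v by (intro assoc_mult_mat_vec[of _ r d _ d] mult_mat_vec_carrier[of _ d d] mult_carrier_mat[of _ r d]) (auto simp: mat_diag_dim)
  also have "\<dots> = J *\<^sub>v (?D *\<^sub>v (?W *\<^sub>v v))"
    using J v by (intro assoc_mult_mat_vec[of _ r d _ d] mult_mat_vec_carrier[of _ d d] mult_carrier_mat[of _ r d]) (auto simp: mat_diag_dim)
  also have "?D *\<^sub>v (?W *\<^sub>v v) = vec d (\<lambda>l. f l * (v $ l / w l))"
    using v by (auto simp: mat_diag_mult_vec[of _ d] divide_inverse mult.commute intro!: eq_vecI)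
  finally show "(J * ?D * inv_mat (mat_diag d w)) *\<^sub>v v = J *\<^sub>v vec d (\<lambda>l. f l * (v $ l / w l))"
    unfolding inv .
qed

abbreviation S_weight :: "nat \<Rightarrow> nat \<Rightarrow> real" where
  "S_weight k l \<equiv> if fst (lower_pairs k ! l) = snd (lower_pairs k ! l) then 1 else sqrt 2"

lemma Phi_mat_diag:
  assumes "X \<in> carrier_mat k k"
  shows "Phi X = mat_diag (k * (k + 1) div 2) (\<lambda>l. Theta X $$ (lower_pairs k ! l))"
proof -
  have "dim_row (Theta X :: real mat) = k" using Theta_carrier[OF assms] by blast
  then show ?thesis
    unfolding Phi_def diag_of_vec_def vec_S_def entries_at_dim length_lower_pairs
    by (intro eq_matI) (auto simp: mat_diag_def entries_at_index length_lower_pairs)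
qed

lemma strict_upper_pairs_eq: "strict_upper_pairs k = map prod.swap (strict_lower_pairs k)"
  by (simp add: strict_upper_pairs_def strict_lower_pairs_def map_concat comp_def)

text \<open>The diagonal of \<open>Psi\<close> is read from the upper triangle, so a symmetric pattern is needed to
  index it by the strict lower triangle.\<close>

lemma Psi_mat_diag:
  assumes X: "X \<in> carrier_mat k k"
    and sym: "transpose_mat (Theta X) = (Theta X :: real mat)"
  shows "Psi X = mat_diag (k * (k - 1) div 2) (\<lambda>l. Theta X $$ (strict_lower_pairs k ! l))"
proof -
  have "Theta X $$ (strict_upper_pairs k ! l) = (Theta X $$ (strict_lower_pairs k ! l) :: real)"
    if l: "l < k * (k - 1) div 2" for l
  proof -
    obtain i j where ij: "strict_lower_pairs k ! l = (i, j)" by (meson surj_pair)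
    have "strict_lower_pairs k ! l \<in> set (strict_lower_pairs k)"
      using l by (simp add: length_strict_lower_pairs)
    then have "i < k" "j < k" by (auto simp: ij set_strict_lower_pairs)
    then show ?thesis
      using l Theta_symmetricD[OF X sym, of i j] Theta_symmetricD[OF X sym, of j i]
      by (auto simp: strict_upper_pairs_eq length_strict_lower_pairs ij Theta_index[OF X])
  qed
  moreover have "dim_row X = k" using X by blast
  moreover have "length (strict_upper_pairs k) = k * (k - 1) div 2"
    by (simp add: strict_upper_pairs_eq length_strict_lower_pairs)
  ultimately show ?thesis
    unfolding Psi_def diag_of_vec_def entries_at_dim
    by (intro eq_matI) (auto simp: mat_diag_def entries_at_index)
qed

lemma D_SK_mat_diag: "D_SK k = mat_diag (k * (k - 1) div 2) (\<lambda>_. sqrt 2)"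
  unfolding D_SK_def by (intro eq_matI) (auto simp: mat_diag_def)

lemma N_S_mult_vec:
  assumes X: "X \<in> carrier_mat k k"
  shows "N_S X \<in> carrier_mat (k * k) (k * (k + 1) div 2)"
    and "v \<in> carrier_vec (k * (k + 1) div 2) \<Longrightarrow> N_S X *\<^sub>v v =
      J_S k *\<^sub>v vec (k * (k + 1) div 2) (\<lambda>l. Theta X $$ (lower_pairs k ! l) * (v $ l / S_weight k l))"
  using mult_diag_inv_diag[OF J_S(1)[of k], where w = "S_weight k" and f = "\<lambda>l. Theta X $$ (lower_pairs k ! l)"] X
  by (simp_all add: N_S_def Phi_mat_diag D_S_def)

lemma N_SK_mult_vec:
  assumes X: "X \<in> carrier_mat k k"
    and sym: "transpose_mat (Theta X) = (Theta X :: real mat)"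
  shows "N_SK X \<in> carrier_mat (k * k) (k * (k - 1) div 2)"
    and "v \<in> carrier_vec (k * (k - 1) div 2) \<Longrightarrow> N_SK X *\<^sub>v v =
      J_SK k *\<^sub>v vec (k * (k - 1) div 2) (\<lambda>l. Theta X $$ (strict_lower_pairs k ! l) * (v $ l / sqrt 2))"
proof -
  have dim: "dim_row X = k" using X by blast
  have "N_SK X = J_SK k * mat_diag (k * (k - 1) div 2) (\<lambda>l. Theta X $$ (strict_lower_pairs k ! l)) *
      inv_mat (mat_diag (k * (k - 1) div 2) (\<lambda>_. sqrt 2))"
    unfolding N_SK_def dim D_SK_mat_diag Psi_mat_diag[OF X sym] ..
  then show "N_SK X \<in> carrier_mat (k * k) (k * (k - 1) div 2)"
    and "v \<in> carrier_vec (k * (k - 1) div 2) \<Longrightarrow> N_SK X *\<^sub>v v =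
      J_SK k *\<^sub>v vec (k * (k - 1) div 2) (\<lambda>l. Theta X $$ (strict_lower_pairs k ! l) * (v $ l / sqrt 2))"
    using mult_diag_inv_diag[OF J_SK(1)[of k], where w = "\<lambda>_. sqrt 2" and f = "\<lambda>l. Theta X $$ (strict_lower_pairs k ! l)"] by simp_all
qed

lemma symmetric_mat_index:
  assumes "Z \<in> carrier_mat k k" "transpose_mat Z = Z" "i < k" "j < k"
  shows "Z $$ (j, i) = Z $$ (i, j)"
  using assms by (metis index_transpose_mat(1) carrier_matD)

lemma skew_mat_index:
  assumes "Z \<in> carrier_mat k k" "transpose_mat Z = - Z" "i < k" "j < k"
  shows "Z $$ (j, i) = - Z $$ (i, j)"
  using assms by (metis index_transpose_mat(1) index_uminus_mat(1) carrier_matD)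

lemma norm_F_symmetric:
  fixes Z :: "real mat"
  assumes Z: "Z \<in> carrier_mat k k" and sym: "transpose_mat Z = Z"
  shows "(norm_F Z)\<^sup>2 = (\<Sum>l<k * (k + 1) div 2. (S_weight k l * Z $$ (lower_pairs k ! l))\<^sup>2)"
proof -
  let ?h = "\<lambda>ij. ((if fst ij = snd ij then 1 else sqrt 2) * Z $$ ij)\<^sup>2"
  have "(\<Sum>l<k * (k + 1) div 2. (S_weight k l * Z $$ (lower_pairs k ! l))\<^sup>2)
      = (\<Sum>ij\<in>set (lower_pairs k). ?h ij)"
    using sum_nth_distinct[OF distinct_lower_pairs, of ?h k] by (simp add: length_lower_pairs)
  also have "set (lower_pairs k) = (SIGMA i:{..<k}. {..i})" by (auto simp: set_lower_pairs)
  also have "(\<Sum>ij\<in>\<dots>. ?h ij) = (\<Sum>i<k. \<Sum>j\<le>i. ?h (i, j))"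
    by (subst sum.Sigma) (auto intro!: sum.cong)
  also have "\<dots> = (\<Sum>i<k. (Z $$ (i, i))\<^sup>2 + (\<Sum>j<i. (Z $$ (i, j))\<^sup>2 + (Z $$ (j, i))\<^sup>2))"
  proof (intro sum.cong refl)
    fix i assume "i \<in> {..<k}"
    then have "Z $$ (j, i) = Z $$ (i, j)" if "j < i" for j
      using symmetric_mat_index[OF Z sym, of i j] that by simp
    then have "(\<Sum>j<i. ?h (i, j)) = (\<Sum>j<i. (Z $$ (i, j))\<^sup>2 + (Z $$ (j, i))\<^sup>2)"
      by (intro sum.cong refl) (simp add: power_mult_distrib)
    moreover have "{..i} = insert i {..<i}" by auto
    ultimately show "(\<Sum>j\<le>i. ?h (i, j)) =
        (Z $$ (i, i))\<^sup>2 + (\<Sum>j<i. (Z $$ (i, j))\<^sup>2 + (Z $$ (j, i))\<^sup>2)"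
      by simp
  qed
  also have "\<dots> = (\<Sum>i<k. \<Sum>j<k. (Z $$ (i, j))\<^sup>2)" by (rule sum_square[symmetric])
  finally show ?thesis using Z by (simp add: norm_F_power2)
qed

lemma norm_F_skew:
  fixes Z :: "real mat"
  assumes Z: "Z \<in> carrier_mat k k" and skew: "transpose_mat Z = - Z"
  shows "(norm_F Z)\<^sup>2 = (\<Sum>l<k * (k - 1) div 2. (sqrt 2 * Z $$ (strict_lower_pairs k ! l))\<^sup>2)"
proof -
  let ?h = "\<lambda>ij. (sqrt 2 * Z $$ ij)\<^sup>2"
  \<comment> \<open>The strict lower triangle omits the diagonal; its vanishing makes the sum agree
    with \<open>sum_square\<close> all the same.\<close>
  have diag: "Z $$ (i, i) = 0" if "i < k" for i using skew_mat_index[OF Z skew that that] by simp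
  have "(\<Sum>l<k * (k - 1) div 2. (sqrt 2 * Z $$ (strict_lower_pairs k ! l))\<^sup>2)
      = (\<Sum>ij\<in>set (strict_lower_pairs k). ?h ij)"
    using sum_nth_distinct[OF distinct_strict_lower_pairs, of ?h k]
    by (simp add: length_strict_lower_pairs)
  also have "set (strict_lower_pairs k) = (SIGMA i:{..<k}. {..<i})"
    by (auto simp: set_strict_lower_pairs)
  also have "(\<Sum>ij\<in>\<dots>. ?h ij) = (\<Sum>i<k. \<Sum>j<i. ?h (i, j))"
    by (subst sum.Sigma) (auto intro!: sum.cong)
  also have "\<dots> = (\<Sum>i<k. (Z $$ (i, i))\<^sup>2 + (\<Sum>j<i. (Z $$ (i, j))\<^sup>2 + (Z $$ (j, i))\<^sup>2))"
  proof (intro sum.cong refl)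
    fix i assume "i \<in> {..<k}"
    then have "Z $$ (j, i) = - Z $$ (i, j)" if "j < i" for j
      using skew_mat_index[OF Z skew, of i j] that by simp
    then have "(\<Sum>j<i. ?h (i, j)) = (\<Sum>j<i. (Z $$ (i, j))\<^sup>2 + (Z $$ (j, i))\<^sup>2)"
      by (intro sum.cong refl) (simp add: power_mult_distrib)
    then show "(\<Sum>j<i. ?h (i, j)) =
        (Z $$ (i, i))\<^sup>2 + (\<Sum>j<i. (Z $$ (i, j))\<^sup>2 + (Z $$ (j, i))\<^sup>2)"
      using diag \<open>i \<in> {..<k}\<close> by simp
  qed
  also have "\<dots> = (\<Sum>i<k. \<Sum>j<k. (Z $$ (i, j))\<^sup>2)" by (rule sum_square[symmetric])
  finally show ?thesis using Z by (simp add: norm_F_power2)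
qed

text \<open>The witness multiplies the lower triangle by exactly the weights that \<open>N_S\<close>
  divides out, and the pattern changes nothing on a sparse \<open>Z\<close>. What reaches
  \<open>J_S\<close> is therefore \<open>vec_S Z\<close>, and the weights make the norms
  equal.\<close>

lemma N_S_surj:
  assumes X: "X \<in> carrier_mat k k" and Z: "Z \<in> carrier_mat k k"
    and sym: "transpose_mat Z = Z" and sparse: "Z \<odot>\<^sub>m Theta X = Z"
  obtains a where "a \<in> carrier_vec (k * (k + 1) div 2)" "N_S X *\<^sub>v a = vec_cols Z"
    "(norm2 a)\<^sup>2 = (norm_F Z)\<^sup>2"
proof
  let ?d = "k * (k + 1) div 2"
  define a where "a = vec ?d (\<lambda>l. S_weight k l * Z $$ (lower_pairs k ! l))"
  show a: "a \<in> carrier_vec ?d" by (simp add: a_def)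
  have "vec ?d (\<lambda>l. Theta X $$ (lower_pairs k ! l) * (a $ l / S_weight k l)) = vec_S Z"
  proof (rule eq_vecI)
    show "dim_vec (vec ?d (\<lambda>l. Theta X $$ (lower_pairs k ! l) * (a $ l / S_weight k l))) = dim_vec (vec_S Z)"
      using Z by (simp add: vec_S_def entries_at_dim length_lower_pairs)
    fix l assume "l < dim_vec (vec_S Z)"
    then have l: "l < ?d" using Z by (simp add: vec_S_def entries_at_dim length_lower_pairs)
    obtain i j where ij: "lower_pairs k ! l = (i, j)" by (meson surj_pair)
    have "lower_pairs k ! l \<in> set (lower_pairs k)" using l by (simp add: length_lower_pairs)
    then have "i < k" "j < k" by (auto simp: ij set_lower_pairs)
    then show "vec ?d (\<lambda>l. Theta X $$ (lower_pairs k ! l) * (a $ l / S_weight k l)) $ l = vec_S Z $ l"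
      using l Z sparse[unfolded hadamard_Theta_eq_iff[OF Z X]]
      by (auto simp: a_def vec_S_def entries_at_index length_lower_pairs ij Theta_index[OF X])
  qed
  then show "N_S X *\<^sub>v a = vec_cols Z" by (simp add: N_S_mult_vec(2)[OF X a] J_S(2)[OF Z sym])
  show "(norm2 a)\<^sup>2 = (norm_F Z)\<^sup>2" by (simp add: norm2_power2 norm_F_symmetric[OF Z sym] a_def)
qed

lemma N_SK_surj:
  assumes X: "X \<in> carrier_mat k k"
    and pat: "transpose_mat (Theta X) = (Theta X :: real mat)"
    and Z: "Z \<in> carrier_mat k k"
    and skew: "transpose_mat Z = - Z" and sparse: "Z \<odot>\<^sub>m Theta X = Z"
  obtains a where "a \<in> carrier_vec (k * (k - 1) div 2)" "N_SK X *\<^sub>v a = vec_cols Z"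
    "(norm2 a)\<^sup>2 = (norm_F Z)\<^sup>2"
proof
  let ?d = "k * (k - 1) div 2" and ?ps = "strict_lower_pairs k"
  define a where "a = vec ?d (\<lambda>l. sqrt 2 * Z $$ (?ps ! l))"
  show a: "a \<in> carrier_vec ?d" by (simp add: a_def)
  have "vec ?d (\<lambda>l. Theta X $$ (?ps ! l) * (a $ l / sqrt 2)) = vec_SK Z"
  proof (rule eq_vecI)
    show "dim_vec (vec ?d (\<lambda>l. Theta X $$ (?ps ! l) * (a $ l / sqrt 2))) = dim_vec (vec_SK Z)"
      using Z by (simp add: vec_SK_def entries_at_dim length_strict_lower_pairs)
    fix l assume "l < dim_vec (vec_SK Z)"
    then have l: "l < ?d" using Z by (simp add: vec_SK_def entries_at_dim length_strict_lower_pairs)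
    obtain i j where ij: "?ps ! l = (i, j)" by (meson surj_pair)
    have "?ps ! l \<in> set ?ps" using l by (simp add: length_strict_lower_pairs)
    then have "i < k" "j < k" by (auto simp: ij set_strict_lower_pairs)
    then show "vec ?d (\<lambda>l. Theta X $$ (?ps ! l) * (a $ l / sqrt 2)) $ l = vec_SK Z $ l"
      using l Z sparse[unfolded hadamard_Theta_eq_iff[OF Z X]]
      by (auto simp: a_def vec_SK_def entries_at_index length_strict_lower_pairs ij Theta_index[OF X])
  qed
  then show "N_SK X *\<^sub>v a = vec_cols Z"
    by (simp add: N_SK_mult_vec(2)[OF X pat a] J_SK(2)[OF Z skew])
  show "(norm2 a)\<^sup>2 = (norm_F Z)\<^sup>2" by (simp add: norm2_power2 norm_F_skew[OF Z skew] a_def)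
qed

text \<open>Coordinates outside the pattern are erased before \<open>J_S\<close> acts, so the norm
  of \<open>Z\<close> can only drop. This is why \<open>N_S_surj\<close> has an equality here
  replaced by an inequality.\<close>

lemma N_S_image:
  assumes X: "X \<in> carrier_mat k k"
    and pat: "transpose_mat (Theta X) = (Theta X :: real mat)"
    and a: "a \<in> carrier_vec (k * (k + 1) div 2)"
  obtains Z where "Z \<in> carrier_mat k k" "transpose_mat Z = Z" "Z \<odot>\<^sub>m Theta X = Z"
    "N_S X *\<^sub>v a = vec_cols Z" "(norm_F Z)\<^sup>2 \<le> (norm2 a)\<^sup>2"
proof -
  let ?d = "k * (k + 1) div 2" and ?ps = "lower_pairs k"
  obtain g where g: "\<And>l. l < ?d \<Longrightarrow> g (?ps ! l) = a $ l / S_weight k l"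
    using ex_function_on_nth[OF distinct_lower_pairs, of k "\<lambda>l. a $ l / S_weight k l"]
    by (auto simp: length_lower_pairs)
  \<comment> \<open>The value at a lower-triangle pair is copied to its mirror position. Symmetry of
    the pattern is what keeps the upper copy inside the pattern.\<close>
  define Z where "Z = mat k k (\<lambda>(i, j). Theta X $$ (max i j, min i j) * g (max i j, min i j))"
  have Z: "Z \<in> carrier_mat k k" by (simp add: Z_def)
  have sym: "transpose_mat Z = Z"
    by (rule eq_matI) (auto simp: Z_def max.commute min.commute)
  have sparse: "Z \<odot>\<^sub>m Theta X = Z"
    unfolding hadamard_Theta_eq_iff[OF Z X]
  proof (intro allI impI)
    fix i j assume "i < k" "j < k" "X $$ (i, j) = 0"
    then show "Z $$ (i, j) = 0"
      using Theta_symmetricD[OF X pat, of i j] by (simp add: Z_def max_def min_def Theta_index[OF X])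
  qed
  have ent: "Z $$ (?ps ! l) = Theta X $$ (?ps ! l) * (a $ l / S_weight k l)" if l: "l < ?d" for l
  proof -
    obtain i j where ij: "?ps ! l = (i, j)" by (meson surj_pair)
    have "?ps ! l \<in> set ?ps" using l by (simp add: length_lower_pairs)
    then have "i < k" "j \<le> i" by (auto simp: ij set_lower_pairs)
    then show ?thesis using g[OF l] by (cases "i = j") (auto simp: Z_def ij max_def min_def)
  qed
  have "vec ?d (\<lambda>l. Theta X $$ (?ps ! l) * (a $ l / S_weight k l)) = vec_S Z"
    using Z by (intro eq_vecI)
      (auto simp: vec_S_def entries_at_dim entries_at_index length_lower_pairs ent)
  then have N: "N_S X *\<^sub>v a = vec_cols Z"
    by (simp add: N_S_mult_vec(2)[OF X a] J_S(2)[OF Z sym])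
  have "(norm_F Z)\<^sup>2 = (\<Sum>l<?d. (Theta X $$ (?ps ! l) * a $ l)\<^sup>2)"
    unfolding norm_F_symmetric[OF Z sym] by (intro sum.cong) (simp_all add: ent)
  also have "\<dots> \<le> (\<Sum>l<?d. (a $ l)\<^sup>2)"
  proof (rule sum_mono)
    fix l assume "l \<in> {..<?d}"
    then have "?ps ! l \<in> set ?ps" by (simp add: length_lower_pairs)
    then have "Theta X $$ (?ps ! l) \<in> {0, 1 :: real}"
      by (auto simp: set_lower_pairs Theta_index[OF X] split: if_splits)
    then show "(Theta X $$ (?ps ! l) * a $ l)\<^sup>2 \<le> (a $ l)\<^sup>2" by auto
  qed
  also have "\<dots> = (norm2 a)\<^sup>2" using a by (simp add: norm2_power2)
  finally show ?thesis using that Z sym sparse N by blast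
qed

text \<open>The same construction with a negated mirror copy and a zero diagonal; all weights are
  now \<open>sqrt 2\<close>.\<close>

lemma N_SK_image:
  assumes X: "X \<in> carrier_mat k k"
    and pat: "transpose_mat (Theta X) = (Theta X :: real mat)"
    and a: "a \<in> carrier_vec (k * (k - 1) div 2)"
  obtains Z where "Z \<in> carrier_mat k k" "transpose_mat Z = - Z" "Z \<odot>\<^sub>m Theta X = Z"
    "N_SK X *\<^sub>v a = vec_cols Z" "(norm_F Z)\<^sup>2 \<le> (norm2 a)\<^sup>2"
proof -
  let ?d = "k * (k - 1) div 2" and ?ps = "strict_lower_pairs k"
  obtain g where g: "\<And>l. l < ?d \<Longrightarrow> g (?ps ! l) = a $ l / sqrt 2"
    using ex_function_on_nth[OF distinct_strict_lower_pairs, of k "\<lambda>l. a $ l / sqrt 2"]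
    by (auto simp: length_strict_lower_pairs)
  define Z where "Z = mat k k (\<lambda>(i, j).
    if j < i then Theta X $$ (i, j) * g (i, j) else if i < j then - (Theta X $$ (j, i) * g (j, i)) else 0)"
  have Z: "Z \<in> carrier_mat k k" by (simp add: Z_def)
  have skew: "transpose_mat Z = - Z"
    by (rule eq_matI) (auto simp: Z_def)
  have sparse: "Z \<odot>\<^sub>m Theta X = Z"
    unfolding hadamard_Theta_eq_iff[OF Z X]
  proof (intro allI impI)
    fix i j assume "i < k" "j < k" "X $$ (i, j) = 0"
    then show "Z $$ (i, j) = 0"
      using Theta_symmetricD[OF X pat, of i j] by (simp add: Z_def Theta_index[OF X])
  qed
  have ent: "Z $$ (?ps ! l) = Theta X $$ (?ps ! l) * (a $ l / sqrt 2)" if l: "l < ?d" for l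
  proof -
    obtain i j where ij: "?ps ! l = (i, j)" by (meson surj_pair)
    have "?ps ! l \<in> set ?ps" using l by (simp add: length_strict_lower_pairs)
    then have "i < k" "j < i" by (auto simp: ij set_strict_lower_pairs)
    then show ?thesis using g[OF l] by (simp add: Z_def ij)
  qed
  have "vec ?d (\<lambda>l. Theta X $$ (?ps ! l) * (a $ l / sqrt 2)) = vec_SK Z"
    using Z by (intro eq_vecI)
      (auto simp: vec_SK_def entries_at_dim entries_at_index length_strict_lower_pairs ent)
  then have N: "N_SK X *\<^sub>v a = vec_cols Z"
    by (simp add: N_SK_mult_vec(2)[OF X pat a] J_SK(2)[OF Z skew])
  have "(norm_F Z)\<^sup>2 = (\<Sum>l<?d. (Theta X $$ (?ps ! l) * a $ l)\<^sup>2)"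
    unfolding norm_F_skew[OF Z skew] by (intro sum.cong) (simp_all add: ent)
  also have "\<dots> \<le> (\<Sum>l<?d. (a $ l)\<^sup>2)"
  proof (rule sum_mono)
    fix l assume "l \<in> {..<?d}"
    then have "?ps ! l \<in> set ?ps" by (simp add: length_strict_lower_pairs)
    then have "Theta X $$ (?ps ! l) \<in> {0, 1 :: real}"
      by (auto simp: set_strict_lower_pairs Theta_index[OF X] split: if_splits)
    then show "(Theta X $$ (?ps ! l) * a $ l)\<^sup>2 \<le> (a $ l)\<^sup>2" by auto
  qed
  also have "\<dots> = (norm2 a)\<^sup>2" using a by (simp add: norm2_power2)
  finally show ?thesis using that Z skew sparse N by blast
qed

section \<open>Blocks without symmetry: the coordinate projection \<open>Sigma_mat\<close>\<close>

lemma Sigma_mat_carrier: "X \<in> carrier_mat r c \<Longrightarrow> Sigma_mat X \<in> carrier_mat (r * c) (r * c)"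
  by (auto simp: Sigma_mat_def diag_of_vec_def vec_cols_def Theta_def mat_diag_def)

lemma Sigma_mat_mult_vec_cols:
  assumes X: "X \<in> carrier_mat r c" and Z: "Z \<in> carrier_mat r c"
  shows "Sigma_mat X *\<^sub>v vec_cols Z = vec_cols (Z \<odot>\<^sub>m Theta X)"
proof -
  have dims: "dim_row (Theta X :: real mat) = r" "dim_col (Theta X :: real mat) = c"
    using Theta_carrier[OF X] by blast+
  have "l mod r < r" if "l < r * c" for l using that by (cases r) auto
  moreover have "l div r < c" if "l < r * c" for l using that by (simp add: less_mult_imp_div_less mult.commute)
  moreover have Sigma: "Sigma_mat X = mat_diag (r * c) (\<lambda>l. vec_cols (Theta X) $ l)"
    by (simp add: Sigma_mat_def diag_of_vec_def vec_cols_def dims)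
  ultimately show ?thesis
    using Z unfolding Sigma mat_diag_mult_vec[OF vec_cols_carrier[OF Z]]
    by (intro eq_vecI) (simp_all add: vec_cols_def dims hadamard_def mult.commute)
qed

lemma vec_cols_surj:
  assumes a: "a \<in> carrier_vec (r * c)"
  obtains Z where "Z \<in> carrier_mat r c" "vec_cols Z = a"
proof
  define Z where "Z = mat r c (\<lambda>(i, j). a $ (j * r + i))"
  show "Z \<in> carrier_mat r c" by (simp add: Z_def)
  have "l mod r < r" if "l < r * c" for l using that by (cases r) auto
  moreover have "l div r < c" if "l < r * c" for l using that by (simp add: less_mult_imp_div_less mult.commute)
  ultimately show "vec_cols Z = a"
    using a by (auto simp: vec_cols_def Z_def intro!: eq_vecI)
qed

text \<open>Any vector of the right length is a stacked matrix \<open>Y\<close>, and the diagonal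
  0-1 matrix \<open>Sigma_mat X\<close> acts on it as masking, which cannot increase the
  norm.\<close>

lemma Sigma_mat_image:
  assumes X: "X \<in> carrier_mat r c" and a: "a \<in> carrier_vec (r * c)"
  obtains Z where "Z \<in> carrier_mat r c" "Z \<odot>\<^sub>m Theta X = Z" "Sigma_mat X *\<^sub>v a = vec_cols Z"
    "(norm_F Z)\<^sup>2 \<le> (norm2 a)\<^sup>2"
proof -
  obtain Y where Y: "Y \<in> carrier_mat r c" "vec_cols Y = a" using vec_cols_surj[OF a] .
  let ?Z = "Y \<odot>\<^sub>m Theta X"
  have Z: "?Z \<in> carrier_mat r c" using Y by (simp add: hadamard_def)
  have "(norm_F ?Z)\<^sup>2 \<le> (norm_F Y)\<^sup>2"
    using X Y unfolding norm_F_power2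
    by (auto simp: hadamard_def Theta_def intro!: sum_mono)
  then show ?thesis
    using that[of ?Z] Z hadamard_Theta_idem[OF Y(1) X] Sigma_mat_mult_vec_cols[OF X Y(1)]
    by (simp add: Y(2) flip: norm2_vec_cols[of Y])
qed

section \<open>Real and imaginary parts\<close>

lemma map_vec_Re_mult:
  assumes "Z \<in> carrier_mat r c" "x \<in> carrier_vec c"
  shows "map_vec Re (Z *\<^sub>v x) =
    map_mat Re Z *\<^sub>v map_vec Re x - map_mat Im Z *\<^sub>v map_vec Im x"
  using assms by (intro eq_vecI) (auto simp: scalar_prod_def sum_subtractf)

lemma map_vec_Im_mult:
  assumes "Z \<in> carrier_mat r c" "x \<in> carrier_vec c"
  shows "map_vec Im (Z *\<^sub>v x) =
    map_mat Re Z *\<^sub>v map_vec Im x + map_mat Im Z *\<^sub>v map_vec Re x"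
  using assms by (intro eq_vecI) (auto simp: scalar_prod_def sum.distrib)

lemma map_vec_Re_Im_add:
  assumes "v \<in> carrier_vec k" "w \<in> carrier_vec k"
  shows "map_vec Re (v + w) = map_vec Re v + map_vec Re w"
    "map_vec Im (v + w) = map_vec Im v + map_vec Im w"
  using assms by (auto intro!: eq_vecI)

lemma map_vec_Re_Im_eqD:
  assumes "map_vec Re v = map_vec Re w" "map_vec Im v = map_vec Im w"
  shows "v = w"
proof (rule eq_vecI)
  show dim: "dim_vec v = dim_vec w" using assms(1) by (metis index_map_vec(2))
  fix i assume i: "i < dim_vec w"
  then have "map_vec Re v $ i = map_vec Re w $ i" "map_vec Im v $ i = map_vec Im w $ i"
    using assms by simp_all
  then show "v $ i = w $ i" using i dim by (simp add: complex_eq_iff)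
qed

section \<open>Adjoints, Hermitian matrices and their patterns\<close>

lemma mat_adjoint_carrier: "A \<in> carrier_mat r c \<Longrightarrow> mat_adjoint A \<in> carrier_mat c r"
  by (auto simp: mat_adjoint_def)

lemma mat_adjoint_index:
  "A \<in> carrier_mat r c \<Longrightarrow> i < c \<Longrightarrow> j < r \<Longrightarrow> mat_adjoint A $$ (i, j) = conjugate (A $$ (j, i))"
  by (auto simp: mat_adjoint_def mat_of_rows_index)

lemma mat_adjoint_add:
  assumes "A \<in> carrier_mat r c" "B \<in> carrier_mat r c"
  shows "mat_adjoint (A + B) = mat_adjoint A + mat_adjoint B"
proof -
  have "A + B \<in> carrier_mat r c" using assms by simp
  note carr = mat_adjoint_carrier[OF assms(1)] mat_adjoint_carrier[OF assms(2)] mat_adjoint_carrier[OF this]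
  show ?thesis
    by (rule eq_matI)
      (use assms carr in \<open>simp_all add: mat_adjoint_index[of _ r c] conjugate_dist_add\<close>)
qed

lemma map_mat_Re_adjoint: "map_mat Re (mat_adjoint Z) = transpose_mat (map_mat Re Z)"
proof -
  have Z: "Z \<in> carrier_mat (dim_row Z) (dim_col Z)" by simp
  show ?thesis
    by (rule eq_matI) (use mat_adjoint_carrier[OF Z] mat_adjoint_index[OF Z] in simp_all)
qed

lemma map_mat_Im_adjoint: "map_mat Im (mat_adjoint Z) = - transpose_mat (map_mat Im Z)"
proof -
  have Z: "Z \<in> carrier_mat (dim_row Z) (dim_col Z)" by simp
  show ?thesis
    by (rule eq_matI) (use mat_adjoint_carrier[OF Z] mat_adjoint_index[OF Z] in simp_all)
qed

lemma map_mat_Re_Im_eqD: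
  assumes "map_mat Re A = map_mat Re B" "map_mat Im A = map_mat Im B"
  shows "A = B"
proof (rule eq_matI)
  show dim: "dim_row A = dim_row B" "dim_col A = dim_col B"
    using assms(1) by (metis index_map_mat(2), metis index_map_mat(3))
  fix i j assume ij: "i < dim_row B" "j < dim_col B"
  then have "map_mat Re A $$ (i, j) = map_mat Re B $$ (i, j)"
    "map_mat Im A $$ (i, j) = map_mat Im B $$ (i, j)"
    using assms by simp_all
  then show "A $$ (i, j) = B $$ (i, j)" using ij dim by (simp add: complex_eq_iff)
qed

text \<open>Taking the adjoint transposes the real part and transposes and negates the imaginary
  part. This splits a Hermitian block into one argument for \<open>N_S\<close> and one for
  \<open>N_SK\<close>.\<close>

lemma hermitian_mat_iff_parts:
  "hermitian_mat Z \<longleftrightarrow>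
    transpose_mat (map_mat Re Z) = map_mat Re Z \<and> transpose_mat (map_mat Im Z) = - map_mat Im Z"
  (is "_ \<longleftrightarrow> ?R")
proof -
  have "hermitian_mat Z \<longleftrightarrow> map_mat Re (mat_adjoint Z) = map_mat Re Z \<and>
      map_mat Im (mat_adjoint Z) = map_mat Im Z"
    unfolding hermitian_mat_def using map_mat_Re_Im_eqD by metis
  also have "\<dots> \<longleftrightarrow> ?R"
    unfolding map_mat_Re_adjoint map_mat_Im_adjoint by (metis uminus_uminus_mat)
  finally show ?thesis .
qed

text \<open>Conjugation sends only 0 to 0, so an entry and its mirror image vanish together.\<close>

lemma hermitian_Theta_symmetric:
  assumes X: "X \<in> carrier_mat k k" and herm: "hermitian_mat X"
  shows "transpose_mat (Theta X) = (Theta X :: real mat)"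
proof (rule eq_matI)
  note T = Theta_carrier[OF X, where ?'b = real]
  show "dim_row (transpose_mat (Theta X :: real mat)) = dim_row (Theta X :: real mat)"
    "dim_col (transpose_mat (Theta X :: real mat)) = dim_col (Theta X :: real mat)"
    using T by auto
  fix i j assume "i < dim_row (Theta X :: real mat)" "j < dim_col (Theta X :: real mat)"
  then have ij: "i < k" "j < k" using T by auto
  then have "X $$ (i, j) = conjugate (X $$ (j, i))"
    using mat_adjoint_index[OF X ij] herm by (simp add: hermitian_mat_def)
  then show "transpose_mat (Theta X :: real mat) $$ (i, j) = Theta X $$ (i, j)"
    using T ij X by (simp add: Theta_index[OF X])
qed

text \<open>A complex entry is 0 iff both parts are. \<open>Theta X\<close> is a complex mask on the
  left of the equivalence and a real one on the right.\<close>

lemma sparse_complex_iff_parts: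
  assumes Z: "Z \<in> carrier_mat r c" and X: "X \<in> carrier_mat r c"
  shows "Z \<odot>\<^sub>m Theta X = Z \<longleftrightarrow> map_mat Re Z \<odot>\<^sub>m Theta X = map_mat Re Z \<and>
    map_mat Im Z \<odot>\<^sub>m Theta X = map_mat Im Z"
proof -
  have "map_mat Re Z \<in> carrier_mat r c" "map_mat Im Z \<in> carrier_mat r c" using Z by simp_all
  then show ?thesis
    using Z by (auto simp: hadamard_Theta_eq_iff[OF _ X] complex_eq_iff)
qed

lemma ex_complex_mat:
  assumes "A \<in> carrier_mat r c" "B \<in> carrier_mat r c"
  obtains Z where "Z \<in> carrier_mat r c" "map_mat Re Z = A" "map_mat Im Z = B"
proof
  show "mat r c (\<lambda>ij. Complex (A $$ ij) (B $$ ij)) \<in> carrier_mat r c" by simp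
qed (use assms in \<open>auto intro!: eq_matI\<close>)

lemma ex_complex_vec:
  assumes "v \<in> carrier_vec k" "w \<in> carrier_vec k"
  obtains z where "z \<in> carrier_vec k" "map_vec Re z = v" "map_vec Im z = w"
proof
  show "vec k (\<lambda>i. Complex (v $ i) (w $ i)) \<in> carrier_vec k" by simp
qed (use assms in \<open>auto intro!: eq_vecI\<close>)

section \<open>Scaled real coordinates of a single perturbation block\<close>

lemma hermitian_coords_surj:
  assumes X: "X \<in> carrier_mat k k" and herm: "hermitian_mat X"
    and Z: "Z \<in> carrier_mat k k" "hermitian_mat Z" "Z \<odot>\<^sub>m Theta X = Z"
  obtains a b where "a \<in> carrier_vec (k * (k + 1) div 2)" "b \<in> carrier_vec (k * (k - 1) div 2)"
    "N_S X *\<^sub>v a = \<alpha> \<cdot>\<^sub>v vec_cols (map_mat Re Z)" "N_SK X *\<^sub>v b = \<alpha> \<cdot>\<^sub>v vec_cols (map_mat Im Z)"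
    "(norm2 a)\<^sup>2 + (norm2 b)\<^sup>2 = \<alpha>\<^sup>2 * (norm_F Z)\<^sup>2"
proof -
  note pat = hermitian_Theta_symmetric[OF X herm]
  have ZR: "map_mat Re Z \<in> carrier_mat k k" and ZI: "map_mat Im Z \<in> carrier_mat k k"
    using Z(1) by simp_all
  note parts = hermitian_mat_iff_parts[THEN iffD1, OF Z(2)]
    sparse_complex_iff_parts[OF Z(1) X, THEN iffD1, OF Z(3)]
  obtain a where a: "a \<in> carrier_vec (k * (k + 1) div 2)" "N_S X *\<^sub>v a = vec_cols (map_mat Re Z)"
    "(norm2 a)\<^sup>2 = (norm_F (map_mat Re Z))\<^sup>2"
    using N_S_surj[OF X ZR] parts by blast
  obtain b where b: "b \<in> carrier_vec (k * (k - 1) div 2)" "N_SK X *\<^sub>v b = vec_cols (map_mat Im Z)"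
    "(norm2 b)\<^sup>2 = (norm_F (map_mat Im Z))\<^sup>2"
    using N_SK_surj[OF X pat ZI] parts by blast
  show ?thesis
  proof (rule that)
    \<comment> \<open>Scaling by \<open>\<alpha>\<close> turns the squared Frobenius norm of
      \<open>Z\<close> into the corresponding summand of \<open>zeta\<close>.\<close>
    show "\<alpha> \<cdot>\<^sub>v a \<in> carrier_vec (k * (k + 1) div 2)" "\<alpha> \<cdot>\<^sub>v b \<in> carrier_vec (k * (k - 1) div 2)"
      using a b by simp_all
    show "N_S X *\<^sub>v (\<alpha> \<cdot>\<^sub>v a) = \<alpha> \<cdot>\<^sub>v vec_cols (map_mat Re Z)"
      using mult_mat_vec[OF N_S_mult_vec(1)[OF X] a(1)] a(2) by simp
    show "N_SK X *\<^sub>v (\<alpha> \<cdot>\<^sub>v b) = \<alpha> \<cdot>\<^sub>v vec_cols (map_mat Im Z)"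
      using mult_mat_vec[OF N_SK_mult_vec(1)[OF X pat] b(1)] b(2) by simp
    show "(norm2 (\<alpha> \<cdot>\<^sub>v a))\<^sup>2 + (norm2 (\<alpha> \<cdot>\<^sub>v b))\<^sup>2 = \<alpha>\<^sup>2 * (norm_F Z)\<^sup>2"
      unfolding norm2_sq_smult norm_F_complex_parts[of Z] a(3) b(3) by (simp add: algebra_simps)
  qed
qed

text \<open>After dividing by \<open>\<alpha>\<close>, the two coordinate vectors produce a
  symmetric and a skew-symmetric sparse matrix, and these are glued together as real and imaginary
  part of \<open>Z\<close>.\<close>

lemma hermitian_coords_image:
  assumes X: "X \<in> carrier_mat k k" and herm: "hermitian_mat X" and \<alpha>: "\<alpha> \<noteq> 0"
    and a: "a \<in> carrier_vec (k * (k + 1) div 2)" and b: "b \<in> carrier_vec (k * (k - 1) div 2)"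
  obtains Z where "Z \<in> carrier_mat k k" "hermitian_mat Z" "Z \<odot>\<^sub>m Theta X = Z"
    "N_S X *\<^sub>v a = \<alpha> \<cdot>\<^sub>v vec_cols (map_mat Re Z)" "N_SK X *\<^sub>v b = \<alpha> \<cdot>\<^sub>v vec_cols (map_mat Im Z)"
    "\<alpha>\<^sup>2 * (norm_F Z)\<^sup>2 \<le> (norm2 a)\<^sup>2 + (norm2 b)\<^sup>2"
proof -
  note pat = hermitian_Theta_symmetric[OF X herm]
  let ?a = "inverse \<alpha> \<cdot>\<^sub>v a" and ?b = "inverse \<alpha> \<cdot>\<^sub>v b"
  have ac: "?a \<in> carrier_vec (k * (k + 1) div 2)" and bc: "?b \<in> carrier_vec (k * (k - 1) div 2)"
    using a b by simp_all
  obtain A where A: "A \<in> carrier_mat k k" "transpose_mat A = A" "A \<odot>\<^sub>m Theta X = A"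
    "N_S X *\<^sub>v ?a = vec_cols A" "(norm_F A)\<^sup>2 \<le> (norm2 ?a)\<^sup>2"
    using N_S_image[OF X pat ac] .
  obtain B where B: "B \<in> carrier_mat k k" "transpose_mat B = - B" "B \<odot>\<^sub>m Theta X = B"
    "N_SK X *\<^sub>v ?b = vec_cols B" "(norm_F B)\<^sup>2 \<le> (norm2 ?b)\<^sup>2"
    using N_SK_image[OF X pat bc] .
  obtain Z where Z: "Z \<in> carrier_mat k k" "map_mat Re Z = A" "map_mat Im Z = B"
    using ex_complex_mat[OF A(1) B(1)] .
  have scale: "\<alpha> \<cdot>\<^sub>v (inverse \<alpha> \<cdot>\<^sub>v v) = v" for v
    using \<alpha> by (simp add: smult_smult_assoc)
  have norms: "\<alpha>\<^sup>2 * (norm2 (inverse \<alpha> \<cdot>\<^sub>v v))\<^sup>2 = (norm2 v)\<^sup>2" for v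
    unfolding norm2_sq_smult[symmetric] scale ..
  show ?thesis
  proof (rule that[OF Z(1)])
    show "hermitian_mat Z" unfolding hermitian_mat_iff_parts Z(2,3) using A B by simp
    show "Z \<odot>\<^sub>m Theta X = Z" unfolding sparse_complex_iff_parts[OF Z(1) X] Z(2,3) using A B by simp
    show "N_S X *\<^sub>v a = \<alpha> \<cdot>\<^sub>v vec_cols (map_mat Re Z)"
      using mult_mat_vec[OF N_S_mult_vec(1)[OF X] ac, of \<alpha>] A(4) by (simp add: Z scale)
    show "N_SK X *\<^sub>v b = \<alpha> \<cdot>\<^sub>v vec_cols (map_mat Im Z)"
      using mult_mat_vec[OF N_SK_mult_vec(1)[OF X pat] bc, of \<alpha>] B(4) by (simp add: Z scale)
    have "\<alpha>\<^sup>2 * (norm_F Z)\<^sup>2 \<le> \<alpha>\<^sup>2 * ((norm2 ?a)\<^sup>2 + (norm2 ?b)\<^sup>2)"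
      unfolding norm_F_complex_parts[of Z] Z(2,3) using A(5) B(5) by (intro mult_left_mono) auto
    then show "\<alpha>\<^sup>2 * (norm_F Z)\<^sup>2 \<le> (norm2 a)\<^sup>2 + (norm2 b)\<^sup>2"
      by (simp add: distrib_left norms)
  qed
qed

text \<open>Without symmetry no entry is redundant: the scaled stacked parts of \<open>Z\<close> are
  themselves the coordinates, since sparsity makes them fixed points of
  \<open>Sigma_mat X\<close>.\<close>

lemma general_coords_surj:
  assumes X: "X \<in> carrier_mat r c" and Z: "Z \<in> carrier_mat r c" "Z \<odot>\<^sub>m Theta X = Z"
  obtains a b where "a \<in> carrier_vec (r * c)" "b \<in> carrier_vec (r * c)"
    "Sigma_mat X *\<^sub>v a = \<alpha> \<cdot>\<^sub>v vec_cols (map_mat Re Z)"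
    "Sigma_mat X *\<^sub>v b = \<alpha> \<cdot>\<^sub>v vec_cols (map_mat Im Z)"
    "(norm2 a)\<^sup>2 + (norm2 b)\<^sup>2 = \<alpha>\<^sup>2 * (norm_F Z)\<^sup>2"
proof (rule that)
  have ZR: "map_mat Re Z \<in> carrier_mat r c" and ZI: "map_mat Im Z \<in> carrier_mat r c"
    using Z(1) by simp_all
  note c = vec_cols_carrier[OF ZR] vec_cols_carrier[OF ZI]
  note parts = sparse_complex_iff_parts[OF Z(1) X, THEN iffD1, OF Z(2)]
  show "\<alpha> \<cdot>\<^sub>v vec_cols (map_mat Re Z) \<in> carrier_vec (r * c)"
    "\<alpha> \<cdot>\<^sub>v vec_cols (map_mat Im Z) \<in> carrier_vec (r * c)"
    using c by simp_all
  show "Sigma_mat X *\<^sub>v (\<alpha> \<cdot>\<^sub>v vec_cols (map_mat Re Z)) = \<alpha> \<cdot>\<^sub>v vec_cols (map_mat Re Z)"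
    "Sigma_mat X *\<^sub>v (\<alpha> \<cdot>\<^sub>v vec_cols (map_mat Im Z)) = \<alpha> \<cdot>\<^sub>v vec_cols (map_mat Im Z)"
    using c parts
    by (simp_all add: mult_mat_vec[OF Sigma_mat_carrier[OF X]] Sigma_mat_mult_vec_cols[OF X ZR]
        Sigma_mat_mult_vec_cols[OF X ZI])
  show "(norm2 (\<alpha> \<cdot>\<^sub>v vec_cols (map_mat Re Z)))\<^sup>2 + (norm2 (\<alpha> \<cdot>\<^sub>v vec_cols (map_mat Im Z)))\<^sup>2 =
      \<alpha>\<^sup>2 * (norm_F Z)\<^sup>2"
    unfolding norm2_sq_smult norm_F_complex_parts[of Z] norm2_vec_cols by (simp add: algebra_simps)
qed

lemma general_coords_image:
  assumes X: "X \<in> carrier_mat r c" and \<alpha>: "\<alpha> \<noteq> 0"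
    and a: "a \<in> carrier_vec (r * c)" and b: "b \<in> carrier_vec (r * c)"
  obtains Z where "Z \<in> carrier_mat r c" "Z \<odot>\<^sub>m Theta X = Z"
    "Sigma_mat X *\<^sub>v a = \<alpha> \<cdot>\<^sub>v vec_cols (map_mat Re Z)"
    "Sigma_mat X *\<^sub>v b = \<alpha> \<cdot>\<^sub>v vec_cols (map_mat Im Z)"
    "\<alpha>\<^sup>2 * (norm_F Z)\<^sup>2 \<le> (norm2 a)\<^sup>2 + (norm2 b)\<^sup>2"
proof -
  let ?a = "inverse \<alpha> \<cdot>\<^sub>v a" and ?b = "inverse \<alpha> \<cdot>\<^sub>v b"
  have ac: "?a \<in> carrier_vec (r * c)" and bc: "?b \<in> carrier_vec (r * c)"
    using a b by simp_all
  obtain A where A: "A \<in> carrier_mat r c" "A \<odot>\<^sub>m Theta X = A"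
    "Sigma_mat X *\<^sub>v ?a = vec_cols A" "(norm_F A)\<^sup>2 \<le> (norm2 ?a)\<^sup>2"
    using Sigma_mat_image[OF X ac] .
  obtain B where B: "B \<in> carrier_mat r c" "B \<odot>\<^sub>m Theta X = B"
    "Sigma_mat X *\<^sub>v ?b = vec_cols B" "(norm_F B)\<^sup>2 \<le> (norm2 ?b)\<^sup>2"
    using Sigma_mat_image[OF X bc] .
  obtain Z where Z: "Z \<in> carrier_mat r c" "map_mat Re Z = A" "map_mat Im Z = B"
    using ex_complex_mat[OF A(1) B(1)] .
  have scale: "\<alpha> \<cdot>\<^sub>v (inverse \<alpha> \<cdot>\<^sub>v v) = v" for v
    using \<alpha> by (simp add: smult_smult_assoc)
  have norms: "\<alpha>\<^sup>2 * (norm2 (inverse \<alpha> \<cdot>\<^sub>v v))\<^sup>2 = (norm2 v)\<^sup>2" for v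
    unfolding norm2_sq_smult[symmetric] scale ..
  show ?thesis
  proof (rule that[OF Z(1)])
    show "Z \<odot>\<^sub>m Theta X = Z" unfolding sparse_complex_iff_parts[OF Z(1) X] Z(2,3) using A B by simp
    show "Sigma_mat X *\<^sub>v a = \<alpha> \<cdot>\<^sub>v vec_cols (map_mat Re Z)"
      using mult_mat_vec[OF Sigma_mat_carrier[OF X] ac, of \<alpha>] A(3) by (simp add: Z scale)
    show "Sigma_mat X *\<^sub>v b = \<alpha> \<cdot>\<^sub>v vec_cols (map_mat Im Z)"
      using mult_mat_vec[OF Sigma_mat_carrier[OF X] bc, of \<alpha>] B(3) by (simp add: Z scale)
    have "\<alpha>\<^sup>2 * (norm_F Z)\<^sup>2 \<le> \<alpha>\<^sup>2 * ((norm2 ?a)\<^sup>2 + (norm2 ?b)\<^sup>2)"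
      unfolding norm_F_complex_parts[of Z] Z(2,3) using A(4) B(4) by (intro mult_left_mono) auto
    then show "\<alpha>\<^sup>2 * (norm_F Z)\<^sup>2 \<le> (norm2 a)\<^sup>2 + (norm2 b)\<^sup>2"
      by (simp add: distrib_left norms)
  qed
qed

section \<open>The block matrix\<close>

lemma smult_mat_mult_vec:
  fixes A :: "'a :: comm_ring_1 mat"
  assumes "A \<in> carrier_mat r c" "v \<in> carrier_vec c"
  shows "(k \<cdot>\<^sub>m A) *\<^sub>v v = k \<cdot>\<^sub>v (A *\<^sub>v v)"
  using assms by (intro eq_vecI) auto

text \<open>The factor \<open>inverse \<alpha>\<close> of the block cancels the scaling of the
  coordinates, so the weights disappear from the equation and survive only in the norm.\<close>

lemma coord_block_mult_vec:
  fixes B :: "'a :: field mat"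
  assumes A: "A \<in> carrier_mat r s" and B: "B \<in> carrier_mat s d" and a: "a \<in> carrier_vec d"
    and z: "z \<in> carrier_vec s" and Ba: "B *\<^sub>v a = \<alpha> \<cdot>\<^sub>v z" and \<alpha>: "\<alpha> \<noteq> 0"
  shows "(inverse \<alpha> \<cdot>\<^sub>m (A * B)) *\<^sub>v a = A *\<^sub>v z"
proof -
  have "(inverse \<alpha> \<cdot>\<^sub>m (A * B)) *\<^sub>v a = inverse \<alpha> \<cdot>\<^sub>v ((A * B) *\<^sub>v a)"
    by (rule smult_mat_mult_vec[OF mult_carrier_mat[OF A B] a])
  also have "(A * B) *\<^sub>v a = \<alpha> \<cdot>\<^sub>v (A *\<^sub>v z)"
    unfolding assoc_mult_mat_vec[OF A B a] Ba by (rule mult_mat_vec[OF A z])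
  finally show ?thesis using \<alpha> by (simp add: smult_smult_assoc)
qed

text \<open>A Hermitian matrix of size \<open>k\<close> has k^2 real parameters, split between its
  real and imaginary part. This reconciles the widths of the coordinate blocks with the column
  counts in \<open>M1\<close> and \<open>M2\<close>.\<close>

lemma triangle_dims: "k * (k + 1) div 2 + k * (k - 1) div 2 = (k\<^sup>2 :: nat)"
proof -
  have "k * (k + 1) div 2 + k * (k - 1) div 2 = (k * (k + 1) + k * (k - 1)) div 2"
    \<comment> \<open>Truncated division distributes because a product of two consecutive numbers is
      even.\<close>
    by (rule div_plus_div_distrib_dvd_left[symmetric]) simp
  also have "k * (k + 1) + k * (k - 1) = k\<^sup>2 * 2"
    by (cases k) (simp_all add: power2_eq_square)
  finally show ?thesis by simp
qed

text \<open>The two block rows of \<open>X1_hat\<close> compute the real and the imaginary part of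
  \<open>Y *\<^sub>v u + mat_adjoint Z *\<^sub>v p\<close>. The adjoint negates the imaginary part
  of \<open>Z\<close>, hence the signs in the column of \<open>g\<close> are + and -, where those in
  the column of \<open>b\<close> are - and +.\<close>

lemma X1_hat_mult_vec:
  assumes E: "E \<in> carrier_mat n n" "hermitian_mat E" and F: "F \<in> carrier_mat m n"
    and u: "u \<in> carrier_vec n" and p: "p \<in> carrier_vec m" and \<alpha>: "\<alpha>1 \<noteq> 0" "\<alpha>2 \<noteq> 0"
  shows "X1_hat n \<alpha>1 \<alpha>2 E F u p \<in> carrier_mat (2 * n) (n\<^sup>2 + 2 * m * n)"
    and "\<lbrakk>Y \<in> carrier_mat n n; Z \<in> carrier_mat m n;
      a \<in> carrier_vec (n * (n + 1) div 2); b \<in> carrier_vec (n * (n - 1) div 2);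
      f \<in> carrier_vec (m * n); g \<in> carrier_vec (m * n);
      N_S E *\<^sub>v a = \<alpha>1 \<cdot>\<^sub>v vec_cols (map_mat Re Y); N_SK E *\<^sub>v b = \<alpha>1 \<cdot>\<^sub>v vec_cols (map_mat Im Y);
      Sigma_mat F *\<^sub>v f = \<alpha>2 \<cdot>\<^sub>v vec_cols (map_mat Re Z);
      Sigma_mat F *\<^sub>v g = \<alpha>2 \<cdot>\<^sub>v vec_cols (map_mat Im Z)\<rbrakk> \<Longrightarrow>
      X1_hat n \<alpha>1 \<alpha>2 E F u p *\<^sub>v (a @\<^sub>v b @\<^sub>v f @\<^sub>v g) =
        map_vec Re (Y *\<^sub>v u + mat_adjoint Z *\<^sub>v p) @\<^sub>v map_vec Im (Y *\<^sub>v u + mat_adjoint Z *\<^sub>v p)"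
proof -
  let ?uR = "map_vec Re u" and ?uI = "map_vec Im u"
  let ?pR = "map_vec Re p" and ?pI = "map_vec Im p"
  let ?s = "n * (n + 1) div 2" and ?t = "n * (n - 1) div 2"
  note NS = N_S_mult_vec(1)[OF E(1)]
  note NSK = N_SK_mult_vec(1)[OF E(1) hermitian_Theta_symmetric[OF E]]
  note Sg = Sigma_mat_carrier[OF F]
  \<comment> \<open>The Kronecker factors and the blocks are kept as functions of a vector, since
    each occurs once with a real and once with an imaginary part.\<close>
  define Ku where "Ku x = mat_of_row x \<otimes>\<^sub>m (1\<^sub>m n :: real mat)" for x
  define Kp where "Kp x = (1\<^sub>m n :: real mat) \<otimes>\<^sub>m mat_of_row x" for x
  have ri: "?uR \<in> carrier_vec n" "?uI \<in> carrier_vec n" "?pR \<in> carrier_vec m" "?pI \<in> carrier_vec m"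
    using u p by simp_all
  have Ku: "Ku x \<in> carrier_mat n (n * n)" if "x \<in> carrier_vec n" for x
    using kronecker_carrier[of "mat_of_row x" 1 n "1\<^sub>m n" n n] that by (auto simp: Ku_def)
  have Kp: "Kp x \<in> carrier_mat n (m * n)" if "x \<in> carrier_vec m" for x
    using kronecker_carrier[of "1\<^sub>m n" n n "mat_of_row x" 1 m] that
    by (auto simp: Kp_def mult.commute)
  define A1 where "A1 x = inverse \<alpha>1 \<cdot>\<^sub>m (Ku x * N_S E)" for x
  define A2 where "A2 x = inverse \<alpha>1 \<cdot>\<^sub>m (Ku x * N_SK E)" for x
  define A3 where "A3 x = inverse \<alpha>2 \<cdot>\<^sub>m (Kp x * Sigma_mat F)" for x
  have A1: "A1 x \<in> carrier_mat n ?s" if "x \<in> carrier_vec n" for x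
    using Ku[OF that] NS by (simp add: A1_def)
  have A2: "A2 x \<in> carrier_mat n ?t" if "x \<in> carrier_vec n" for x
    using Ku[OF that] NSK by (simp add: A2_def)
  have A3: "A3 x \<in> carrier_mat n (m * n)" if "x \<in> carrier_vec m" for x
    using Kp[OF that] Sg by (simp add: A3_def)
  have eq: "X1_hat n \<alpha>1 \<alpha>2 E F u p = (A1 ?uR @\<^sub>c - A2 ?uI @\<^sub>c A3 ?pR @\<^sub>c A3 ?pI) @\<^sub>r
      (A1 ?uI @\<^sub>c A2 ?uR @\<^sub>c A3 ?pI @\<^sub>c - A3 ?pR)"
    unfolding X1_hat_def Let_def A1_def A2_def A3_def Ku_def Kp_def ..
  note carr = A1[OF ri(1)] A1[OF ri(2)] A2[OF ri(1)] A2[OF ri(2)]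
    uminus_carrier_mat[OF A2[OF ri(2)]] A3[OF ri(3)] A3[OF ri(4)] uminus_carrier_mat[OF A3[OF ri(3)]]
  have T: "A1 ?uR @\<^sub>c - A2 ?uI @\<^sub>c A3 ?pR @\<^sub>c A3 ?pI \<in> carrier_mat n (?s + (?t + (m * n + m * n)))"
    and B: "A1 ?uI @\<^sub>c A2 ?uR @\<^sub>c A3 ?pI @\<^sub>c - A3 ?pR \<in> carrier_mat n (?s + (?t + (m * n + m * n)))"
    by (intro append_cols_carrier carr)+
  have dim: "?s + (?t + (m * n + m * n)) = n\<^sup>2 + 2 * m * n"
    using triangle_dims[of n] by simp
  show "X1_hat n \<alpha>1 \<alpha>2 E F u p \<in> carrier_mat (2 * n) (n\<^sup>2 + 2 * m * n)"
    using carrier_append_rows[OF T B] by (simp only: eq dim mult_2)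
  assume Y: "Y \<in> carrier_mat n n" and Z: "Z \<in> carrier_mat m n"
    and a: "a \<in> carrier_vec ?s" and b: "b \<in> carrier_vec ?t"
    and f: "f \<in> carrier_vec (m * n)" and g: "g \<in> carrier_vec (m * n)"
    and coords: "N_S E *\<^sub>v a = \<alpha>1 \<cdot>\<^sub>v vec_cols (map_mat Re Y)" "N_SK E *\<^sub>v b = \<alpha>1 \<cdot>\<^sub>v vec_cols (map_mat Im Y)"
      "Sigma_mat F *\<^sub>v f = \<alpha>2 \<cdot>\<^sub>v vec_cols (map_mat Re Z)"
      "Sigma_mat F *\<^sub>v g = \<alpha>2 \<cdot>\<^sub>v vec_cols (map_mat Im Z)"
  have YR: "map_mat Re Y \<in> carrier_mat n n" and YI: "map_mat Im Y \<in> carrier_mat n n"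
    and ZR: "map_mat Re Z \<in> carrier_mat m n" and ZI: "map_mat Im Z \<in> carrier_mat m n"
    using Y Z by simp_all
  have A1a: "A1 x *\<^sub>v a = map_mat Re Y *\<^sub>v x" if "x \<in> carrier_vec n" for x
    unfolding A1_def coord_block_mult_vec[OF Ku[OF that] NS a vec_cols_carrier[OF YR] coords(1) \<alpha>(1)]
    unfolding Ku_def by (rule kronecker_row_one_mult_vec_cols[OF YR that])
  have A2b: "A2 x *\<^sub>v b = map_mat Im Y *\<^sub>v x" if "x \<in> carrier_vec n" for x
    unfolding A2_def coord_block_mult_vec[OF Ku[OF that] NSK b vec_cols_carrier[OF YI] coords(2) \<alpha>(1)]
    unfolding Ku_def by (rule kronecker_row_one_mult_vec_cols[OF YI that])
  have A3f: "A3 x *\<^sub>v f = transpose_mat (map_mat Re Z) *\<^sub>v x" if "x \<in> carrier_vec m" for x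
    unfolding A3_def coord_block_mult_vec[OF Kp[OF that] Sg f vec_cols_carrier[OF ZR] coords(3) \<alpha>(2)]
    unfolding Kp_def by (rule kronecker_one_row_mult_vec_cols[OF ZR that])
  have A3g: "A3 x *\<^sub>v g = transpose_mat (map_mat Im Z) *\<^sub>v x" if "x \<in> carrier_vec m" for x
    unfolding A3_def coord_block_mult_vec[OF Kp[OF that] Sg g vec_cols_carrier[OF ZI] coords(4) \<alpha>(2)]
    unfolding Kp_def by (rule kronecker_one_row_mult_vec_cols[OF ZI that])
  have fg: "f @\<^sub>v g \<in> carrier_vec (m * n + m * n)"
    and bfg: "b @\<^sub>v f @\<^sub>v g \<in> carrier_vec (?t + (m * n + m * n))"
    and abfg: "a @\<^sub>v b @\<^sub>v f @\<^sub>v g \<in> carrier_vec (?s + (?t + (m * n + m * n)))"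
    using a b f g by (auto intro!: carrier_vecI)
  have split: "(C1 @\<^sub>c C2 @\<^sub>c C3 @\<^sub>c C4) *\<^sub>v (a @\<^sub>v b @\<^sub>v f @\<^sub>v g) =
      C1 *\<^sub>v a + (C2 *\<^sub>v b + (C3 *\<^sub>v f + C4 *\<^sub>v g))"
    if C: "C1 \<in> carrier_mat n ?s" "C2 \<in> carrier_mat n ?t" "C3 \<in> carrier_mat n (m * n)"
      "C4 \<in> carrier_mat n (m * n)" for C1 C2 C3 C4 :: "real mat"
    unfolding append_cols_mult_vec[OF C(1) append_cols_carrier[OF C(2) append_cols_carrier[OF C(3,4)]] a bfg]
      append_cols_mult_vec[OF C(2) append_cols_carrier[OF C(3,4)] b fg]
      append_cols_mult_vec[OF C(3,4) f g] ..
  have neg: "(- A2 ?uI) *\<^sub>v b = - (A2 ?uI *\<^sub>v b)" "(- A3 ?pR) *\<^sub>v g = - (A3 ?pR *\<^sub>v g)"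
    using carrier_vecD[OF b] carrier_vecD[OF g] carrier_matD(2)[OF A2[OF ri(2)]]
      carrier_matD(2)[OF A3[OF ri(3)]]
    by simp_all
  have S: "Y *\<^sub>v u \<in> carrier_vec n" "mat_adjoint Z *\<^sub>v p \<in> carrier_vec n"
    using Y u p mat_adjoint_carrier[OF Z] by simp_all
  note parts = map_vec_Re_mult[OF Y u] map_vec_Re_mult[OF mat_adjoint_carrier[OF Z] p]
    map_vec_Im_mult[OF Y u] map_vec_Im_mult[OF mat_adjoint_carrier[OF Z] p]
    map_mat_Re_adjoint map_mat_Im_adjoint
  have re: "map_vec Re (Y *\<^sub>v u + mat_adjoint Z *\<^sub>v p) =
      map_mat Re Y *\<^sub>v ?uR + (- (map_mat Im Y *\<^sub>v ?uI) +
        (transpose_mat (map_mat Re Z) *\<^sub>v ?pR + transpose_mat (map_mat Im Z) *\<^sub>v ?pI))"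
    unfolding map_vec_Re_Im_add[OF S] parts using Y Z u p by (intro eq_vecI) auto
  have im: "map_vec Im (Y *\<^sub>v u + mat_adjoint Z *\<^sub>v p) =
      map_mat Re Y *\<^sub>v ?uI + (map_mat Im Y *\<^sub>v ?uR +
        (transpose_mat (map_mat Re Z) *\<^sub>v ?pI + - (transpose_mat (map_mat Im Z) *\<^sub>v ?pR)))"
    unfolding map_vec_Re_Im_add[OF S] parts using Y Z u p by (intro eq_vecI) auto
  show "X1_hat n \<alpha>1 \<alpha>2 E F u p *\<^sub>v (a @\<^sub>v b @\<^sub>v f @\<^sub>v g) =
      map_vec Re (Y *\<^sub>v u + mat_adjoint Z *\<^sub>v p) @\<^sub>v map_vec Im (Y *\<^sub>v u + mat_adjoint Z *\<^sub>v p)"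
    unfolding eq mat_mult_append[OF T B abfg] split[OF carr(1,5,6,7)] split[OF carr(2,3,7,8)]
      neg A1a[OF ri(1)] A1a[OF ri(2)] A2b[OF ri(1)] A2b[OF ri(2)] A3f[OF ri(3)] A3f[OF ri(4)]
      A3g[OF ri(3)] A3g[OF ri(4)] re im ..
qed

text \<open>The second equation contains no adjoint, so both columns for imaginary parts carry the
  signs of an ordinary complex product. The coordinates of the unsymmetric block come first here,
  those of the Hermitian block last.\<close>

lemma M2_hat_mult_vec:
  assumes G: "G \<in> carrier_mat m m" "hermitian_mat G" and H: "H \<in> carrier_mat m n"
    and u: "u \<in> carrier_vec n" and p: "p \<in> carrier_vec m" and \<alpha>: "\<alpha>3 \<noteq> 0" "\<alpha>4 \<noteq> 0"
  shows "M2_hat m \<alpha>3 \<alpha>4 H G u p \<in> carrier_mat (2 * m) (m\<^sup>2 + 2 * m * n)"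
    and "\<lbrakk>Y \<in> carrier_mat m n; Z \<in> carrier_mat m m;
      f \<in> carrier_vec (m * n); g \<in> carrier_vec (m * n);
      a \<in> carrier_vec (m * (m + 1) div 2); b \<in> carrier_vec (m * (m - 1) div 2);
      Sigma_mat H *\<^sub>v f = \<alpha>3 \<cdot>\<^sub>v vec_cols (map_mat Re Y);
      Sigma_mat H *\<^sub>v g = \<alpha>3 \<cdot>\<^sub>v vec_cols (map_mat Im Y);
      N_S G *\<^sub>v a = \<alpha>4 \<cdot>\<^sub>v vec_cols (map_mat Re Z);
      N_SK G *\<^sub>v b = \<alpha>4 \<cdot>\<^sub>v vec_cols (map_mat Im Z)\<rbrakk> \<Longrightarrow>
      M2_hat m \<alpha>3 \<alpha>4 H G u p *\<^sub>v (f @\<^sub>v g @\<^sub>v a @\<^sub>v b) =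
        map_vec Re (Y *\<^sub>v u + Z *\<^sub>v p) @\<^sub>v map_vec Im (Y *\<^sub>v u + Z *\<^sub>v p)"
proof -
  let ?uR = "map_vec Re u" and ?uI = "map_vec Im u"
  let ?pR = "map_vec Re p" and ?pI = "map_vec Im p"
  let ?s = "m * (m + 1) div 2" and ?t = "m * (m - 1) div 2"
  note NS = N_S_mult_vec(1)[OF G(1)]
  note NSK = N_SK_mult_vec(1)[OF G(1) hermitian_Theta_symmetric[OF G]]
  note Sg = Sigma_mat_carrier[OF H]
  define K where "K x = mat_of_row x \<otimes>\<^sub>m (1\<^sub>m m :: real mat)" for x
  have ri: "?uR \<in> carrier_vec n" "?uI \<in> carrier_vec n" "?pR \<in> carrier_vec m" "?pI \<in> carrier_vec m"
    using u p by simp_all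
  have K: "K x \<in> carrier_mat m (m * c)" if "x \<in> carrier_vec c" for x c
    using kronecker_carrier[of "mat_of_row x" 1 c "1\<^sub>m m" m m] that
    by (auto simp: K_def mult.commute)
  define A1 where "A1 x = inverse \<alpha>3 \<cdot>\<^sub>m (K x * Sigma_mat H)" for x
  define A2 where "A2 x = inverse \<alpha>4 \<cdot>\<^sub>m (K x * N_S G)" for x
  define A3 where "A3 x = inverse \<alpha>4 \<cdot>\<^sub>m (K x * N_SK G)" for x
  have A1: "A1 x \<in> carrier_mat m (m * n)" if "x \<in> carrier_vec n" for x
    using K[OF that] Sg by (simp add: A1_def)
  have A2: "A2 x \<in> carrier_mat m ?s" if "x \<in> carrier_vec m" for x
    using K[OF that] NS by (simp add: A2_def)
  have A3: "A3 x \<in> carrier_mat m ?t" if "x \<in> carrier_vec m" for x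
    using K[OF that] NSK by (simp add: A3_def)
  have eq: "M2_hat m \<alpha>3 \<alpha>4 H G u p = (A1 ?uR @\<^sub>c - A1 ?uI @\<^sub>c A2 ?pR @\<^sub>c - A3 ?pI) @\<^sub>r
      (A1 ?uI @\<^sub>c A1 ?uR @\<^sub>c A2 ?pI @\<^sub>c A3 ?pR)"
    unfolding M2_hat_def Let_def A1_def A2_def A3_def K_def ..
  note carr = A1[OF ri(1)] A1[OF ri(2)] uminus_carrier_mat[OF A1[OF ri(2)]]
    A2[OF ri(3)] A2[OF ri(4)] A3[OF ri(3)] A3[OF ri(4)] uminus_carrier_mat[OF A3[OF ri(4)]]
  have T: "A1 ?uR @\<^sub>c - A1 ?uI @\<^sub>c A2 ?pR @\<^sub>c - A3 ?pI \<in> carrier_mat m (m * n + (m * n + (?s + ?t)))"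
    and B: "A1 ?uI @\<^sub>c A1 ?uR @\<^sub>c A2 ?pI @\<^sub>c A3 ?pR \<in> carrier_mat m (m * n + (m * n + (?s + ?t)))"
    by (intro append_cols_carrier carr)+
  have dim: "m * n + (m * n + (?s + ?t)) = m\<^sup>2 + 2 * m * n"
    using triangle_dims[of m] by simp
  show "M2_hat m \<alpha>3 \<alpha>4 H G u p \<in> carrier_mat (2 * m) (m\<^sup>2 + 2 * m * n)"
    using carrier_append_rows[OF T B] by (simp only: eq dim mult_2)
  assume Y: "Y \<in> carrier_mat m n" and Z: "Z \<in> carrier_mat m m"
    and f: "f \<in> carrier_vec (m * n)" and g: "g \<in> carrier_vec (m * n)"
    and a: "a \<in> carrier_vec ?s" and b: "b \<in> carrier_vec ?t"
    and coords: "Sigma_mat H *\<^sub>v f = \<alpha>3 \<cdot>\<^sub>v vec_cols (map_mat Re Y)"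
      "Sigma_mat H *\<^sub>v g = \<alpha>3 \<cdot>\<^sub>v vec_cols (map_mat Im Y)"
      "N_S G *\<^sub>v a = \<alpha>4 \<cdot>\<^sub>v vec_cols (map_mat Re Z)"
      "N_SK G *\<^sub>v b = \<alpha>4 \<cdot>\<^sub>v vec_cols (map_mat Im Z)"
  have YR: "map_mat Re Y \<in> carrier_mat m n" and YI: "map_mat Im Y \<in> carrier_mat m n"
    and ZR: "map_mat Re Z \<in> carrier_mat m m" and ZI: "map_mat Im Z \<in> carrier_mat m m"
    using Y Z by simp_all
  have A1f: "A1 x *\<^sub>v f = map_mat Re Y *\<^sub>v x" if "x \<in> carrier_vec n" for x
    unfolding A1_def coord_block_mult_vec[OF K[OF that] Sg f vec_cols_carrier[OF YR] coords(1) \<alpha>(1)]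
    unfolding K_def by (rule kronecker_row_one_mult_vec_cols[OF YR that])
  have A1g: "A1 x *\<^sub>v g = map_mat Im Y *\<^sub>v x" if "x \<in> carrier_vec n" for x
    unfolding A1_def coord_block_mult_vec[OF K[OF that] Sg g vec_cols_carrier[OF YI] coords(2) \<alpha>(1)]
    unfolding K_def by (rule kronecker_row_one_mult_vec_cols[OF YI that])
  have A2a: "A2 x *\<^sub>v a = map_mat Re Z *\<^sub>v x" if "x \<in> carrier_vec m" for x
    unfolding A2_def coord_block_mult_vec[OF K[OF that] NS a vec_cols_carrier[OF ZR] coords(3) \<alpha>(2)]
    unfolding K_def by (rule kronecker_row_one_mult_vec_cols[OF ZR that])
  have A3b: "A3 x *\<^sub>v b = map_mat Im Z *\<^sub>v x" if "x \<in> carrier_vec m" for x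
    unfolding A3_def coord_block_mult_vec[OF K[OF that] NSK b vec_cols_carrier[OF ZI] coords(4) \<alpha>(2)]
    unfolding K_def by (rule kronecker_row_one_mult_vec_cols[OF ZI that])
  have ab: "a @\<^sub>v b \<in> carrier_vec (?s + ?t)"
    and gab: "g @\<^sub>v a @\<^sub>v b \<in> carrier_vec (m * n + (?s + ?t))"
    and fgab: "f @\<^sub>v g @\<^sub>v a @\<^sub>v b \<in> carrier_vec (m * n + (m * n + (?s + ?t)))"
    using a b f g by (auto intro!: carrier_vecI)
  have split: "(C1 @\<^sub>c C2 @\<^sub>c C3 @\<^sub>c C4) *\<^sub>v (f @\<^sub>v g @\<^sub>v a @\<^sub>v b) =
      C1 *\<^sub>v f + (C2 *\<^sub>v g + (C3 *\<^sub>v a + C4 *\<^sub>v b))"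
    if C: "C1 \<in> carrier_mat m (m * n)" "C2 \<in> carrier_mat m (m * n)" "C3 \<in> carrier_mat m ?s"
      "C4 \<in> carrier_mat m ?t" for C1 C2 C3 C4 :: "real mat"
    unfolding append_cols_mult_vec[OF C(1) append_cols_carrier[OF C(2) append_cols_carrier[OF C(3,4)]] f gab]
      append_cols_mult_vec[OF C(2) append_cols_carrier[OF C(3,4)] g ab]
      append_cols_mult_vec[OF C(3,4) a b] ..
  have neg: "(- A1 ?uI) *\<^sub>v g = - (A1 ?uI *\<^sub>v g)" "(- A3 ?pI) *\<^sub>v b = - (A3 ?pI *\<^sub>v b)"
    using carrier_vecD[OF b] carrier_vecD[OF g] carrier_matD(2)[OF A1[OF ri(2)]]
      carrier_matD(2)[OF A3[OF ri(4)]]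
    by simp_all
  have S: "Y *\<^sub>v u \<in> carrier_vec m" "Z *\<^sub>v p \<in> carrier_vec m"
    using Y Z u p by simp_all
  note parts = map_vec_Re_mult[OF Y u] map_vec_Re_mult[OF Z p]
    map_vec_Im_mult[OF Y u] map_vec_Im_mult[OF Z p]
  have re: "map_vec Re (Y *\<^sub>v u + Z *\<^sub>v p) =
      map_mat Re Y *\<^sub>v ?uR + (- (map_mat Im Y *\<^sub>v ?uI) +
        (map_mat Re Z *\<^sub>v ?pR + - (map_mat Im Z *\<^sub>v ?pI)))"
    unfolding map_vec_Re_Im_add[OF S] parts using Y Z u p by (intro eq_vecI) auto
  have im: "map_vec Im (Y *\<^sub>v u + Z *\<^sub>v p) =
      map_mat Re Y *\<^sub>v ?uI + (map_mat Im Y *\<^sub>v ?uR +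
        (map_mat Re Z *\<^sub>v ?pI + map_mat Im Z *\<^sub>v ?pR))"
    unfolding map_vec_Re_Im_add[OF S] parts using Y Z u p by (intro eq_vecI) auto
  show "M2_hat m \<alpha>3 \<alpha>4 H G u p *\<^sub>v (f @\<^sub>v g @\<^sub>v a @\<^sub>v b) =
      map_vec Re (Y *\<^sub>v u + Z *\<^sub>v p) @\<^sub>v map_vec Im (Y *\<^sub>v u + Z *\<^sub>v p)"
    unfolding eq mat_mult_append[OF T B fgab] split[OF carr(1,3,4,8)] split[OF carr(2,1,5,6)]
      neg A1f[OF ri(1)] A1f[OF ri(2)] A1g[OF ri(1)] A1g[OF ri(2)] A2a[OF ri(3)] A2a[OF ri(4)]
      A3b[OF ri(3)] A3b[OF ri(4)] re im ..
qed

section \<open>Feasible perturbations and solutions of the linear system\<close>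

lemma I1_carrier: "I1 n m \<beta> \<in> carrier_mat (2 * n) (2 * n + 2 * m)"
  unfolding I1_def by (intro append_cols_carrier) auto

lemma I2_carrier: "I2 n m \<beta> \<in> carrier_mat (2 * m) (2 * n + 2 * m)"
  unfolding I2_def by (intro append_cols_carrier) auto

lemma I1_mult_vec:
  assumes z: "z \<in> carrier_vec (2 * n)" and w: "w \<in> carrier_vec (2 * m)"
  shows "I1 n m \<beta> *\<^sub>v (z @\<^sub>v w) = - (inverse \<beta> \<cdot>\<^sub>v z)"
proof -
  have "I1 n m \<beta> *\<^sub>v (z @\<^sub>v w) = - (inverse \<beta> \<cdot>\<^sub>m 1\<^sub>m (2 * n)) *\<^sub>v z + 0\<^sub>m (2 * n) (2 * m) *\<^sub>v w"
    unfolding I1_def by (rule append_cols_mult_vec) (use z w in auto)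
  also have "- (inverse \<beta> \<cdot>\<^sub>m 1\<^sub>m (2 * n)) *\<^sub>v z = - (inverse \<beta> \<cdot>\<^sub>v z)"
    using z smult_mat_mult_vec[OF one_carrier_mat z, of "inverse \<beta>"] by simp
  finally show ?thesis using z w by (auto intro!: eq_vecI)
qed

lemma I2_mult_vec:
  assumes z: "z \<in> carrier_vec (2 * n)" and w: "w \<in> carrier_vec (2 * m)"
  shows "I2 n m \<beta> *\<^sub>v (z @\<^sub>v w) = - (inverse \<beta> \<cdot>\<^sub>v w)"
proof -
  have "I2 n m \<beta> *\<^sub>v (z @\<^sub>v w) = 0\<^sub>m (2 * m) (2 * n) *\<^sub>v z + - (inverse \<beta> \<cdot>\<^sub>m 1\<^sub>m (2 * m)) *\<^sub>v w"
    unfolding I2_def by (rule append_cols_mult_vec) (use z w in auto)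
  also have "- (inverse \<beta> \<cdot>\<^sub>m 1\<^sub>m (2 * m)) *\<^sub>v w = - (inverse \<beta> \<cdot>\<^sub>v w)"
    using w smult_mat_mult_vec[OF one_carrier_mat w, of "inverse \<beta>"] by simp
  finally show ?thesis using z w by (auto intro!: eq_vecI)
qed

lemma split_append_vec:
  assumes "v \<in> carrier_vec (a + b)"
  obtains x y where "x \<in> carrier_vec a" "y \<in> carrier_vec b" "v = x @\<^sub>v y"
proof
  show "v = vec_first v a @\<^sub>v vec_last v b" using assms by simp
qed simp_all

section \<open>The real linear system \<open>K y = rhs\<close> of a fixed problem\<close>

locale sparse_saddle_problem =
  fixes n m :: nat
    and E F H G :: "complex mat"
    and q r u p :: "complex vec"
    and \<alpha>1 \<alpha>2 \<alpha>3 \<alpha>4 \<beta>1 \<beta>2 :: real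
  assumes E: "E \<in> carrier_mat n n" "hermitian_mat E"
    and G: "G \<in> carrier_mat m m" "hermitian_mat G"
    and F: "F \<in> carrier_mat m n" and H: "H \<in> carrier_mat m n"
    and q: "q \<in> carrier_vec n" and r: "r \<in> carrier_vec m"
    and pos: "\<alpha>1 > 0" "\<alpha>2 > 0" "\<alpha>3 > 0" "\<alpha>4 > 0" "\<beta>1 > 0" "\<beta>2 > 0"
    and u: "u \<in> carrier_vec n" and p: "p \<in> carrier_vec m"
begin

definition Q :: "complex vec" where "Q = q - E *\<^sub>v u - mat_adjoint F *\<^sub>v p"

definition R :: "complex vec" where "R = r - H *\<^sub>v u - G *\<^sub>v p"

definition K :: "real mat" where
  "K = four_block_mat (M1 n m \<alpha>1 \<alpha>2 E F u p) (I1 n m \<beta>1) (M2 n m \<alpha>3 \<alpha>4 H G u p) (I2 n m \<beta>2)"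

definition rhs :: "real vec" where
  "rhs = map_vec Re Q @\<^sub>v map_vec Im Q @\<^sub>v map_vec Re R @\<^sub>v map_vec Im R"

abbreviation d1 :: nat where "d1 \<equiv> n\<^sup>2 + 2 * m * n"
abbreviation d2 :: nat where "d2 \<equiv> m\<^sup>2 + 2 * m * n"

lemmas X1 = X1_hat_mult_vec[OF E F u p less_imp_neq[OF pos(1), symmetric] less_imp_neq[OF pos(2), symmetric]]
lemmas M2h = M2_hat_mult_vec[OF G H u p less_imp_neq[OF pos(3), symmetric] less_imp_neq[OF pos(4), symmetric]]

lemma QR_carrier: "Q \<in> carrier_vec n" "R \<in> carrier_vec m"
  using E G H q r u p mat_adjoint_carrier[OF F] by (simp_all add: Q_def R_def)

lemma M1_carrier: "M1 n m \<alpha>1 \<alpha>2 E F u p \<in> carrier_mat (2 * n) (d1 + d2)"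
  unfolding M1_def by (intro append_cols_carrier X1) simp

lemma M2_carrier: "M2 n m \<alpha>3 \<alpha>4 H G u p \<in> carrier_mat (2 * m) (d1 + d2)"
  unfolding M2_def by (intro append_cols_carrier M2h) simp

lemma K_carrier: "K \<in> carrier_mat (2 * n + 2 * m) ((d1 + d2) + (2 * n + 2 * m))"
  unfolding K_def by (rule four_block_carrier_mat[OF M1_carrier I2_carrier])

lemma rhs_append: "rhs = (map_vec Re Q @\<^sub>v map_vec Im Q) @\<^sub>v (map_vec Re R @\<^sub>v map_vec Im R)"
  by (simp add: rhs_def append_vec_assoc)

lemma rhs_carrier: "rhs \<in> carrier_vec (2 * n + 2 * m)"
  using QR_carrier by (auto simp: rhs_def intro!: carrier_vecI)

text \<open>The zero blocks decouple the two block rows: \<open>x\<close> and \<open>z\<close> enter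
  only the first, \<open>y\<close> and \<open>w\<close> only the second.\<close>

lemma K_mult_vec:
  assumes x: "x \<in> carrier_vec d1" and y: "y \<in> carrier_vec d2"
    and z: "z \<in> carrier_vec (2 * n)" and w: "w \<in> carrier_vec (2 * m)"
  shows "K *\<^sub>v ((x @\<^sub>v y) @\<^sub>v (z @\<^sub>v w)) =
    (X1_hat n \<alpha>1 \<alpha>2 E F u p *\<^sub>v x - inverse \<beta>1 \<cdot>\<^sub>v z) @\<^sub>v
    (M2_hat m \<alpha>3 \<alpha>4 H G u p *\<^sub>v y - inverse \<beta>2 \<cdot>\<^sub>v w)"
proof -
  have xy: "x @\<^sub>v y \<in> carrier_vec (d1 + d2)" and zw: "z @\<^sub>v w \<in> carrier_vec (2 * n + 2 * m)"
    using x y z w by (auto intro!: carrier_vecI)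
  have M1: "M1 n m \<alpha>1 \<alpha>2 E F u p *\<^sub>v (x @\<^sub>v y) = X1_hat n \<alpha>1 \<alpha>2 E F u p *\<^sub>v x"
    unfolding M1_def append_cols_mult_vec[OF X1(1) zero_carrier_mat x y]
    using y carrier_matD(1)[OF X1(1)] by (auto intro!: eq_vecI)
  have M2: "M2 n m \<alpha>3 \<alpha>4 H G u p *\<^sub>v (x @\<^sub>v y) = M2_hat m \<alpha>3 \<alpha>4 H G u p *\<^sub>v y"
    unfolding M2_def append_cols_mult_vec[OF zero_carrier_mat M2h(1) x y]
    using x carrier_matD(1)[OF M2h(1)] by (auto intro!: eq_vecI)
  have minus: "a + - b = a - b" if "a \<in> carrier_vec k" "b \<in> carrier_vec k" for a b :: "real vec" and k
    using that by (auto intro!: eq_vecI)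
  have "X1_hat n \<alpha>1 \<alpha>2 E F u p *\<^sub>v x \<in> carrier_vec (2 * n)"
    "M2_hat m \<alpha>3 \<alpha>4 H G u p *\<^sub>v y \<in> carrier_vec (2 * m)"
    using X1(1) M2h(1) x y by (auto intro: mult_mat_vec_carrier)
  moreover have "inverse \<beta>1 \<cdot>\<^sub>v z \<in> carrier_vec (2 * n)" "inverse \<beta>2 \<cdot>\<^sub>v w \<in> carrier_vec (2 * m)"
    using z w by simp_all
  ultimately show ?thesis
    unfolding K_def four_block_mat_mult_vec[OF M1_carrier I1_carrier M2_carrier I2_carrier xy zw]
      M1 M2 I1_mult_vec[OF z w] I2_mult_vec[OF z w]
    by (simp add: minus)
qed

lemma K_surj:
  assumes v: "v \<in> carrier_vec (2 * n + 2 * m)"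
  shows "\<exists>y \<in> carrier_vec ((d1 + d2) + (2 * n + 2 * m)). K *\<^sub>v y = v"
proof -
  obtain z w where zw: "z \<in> carrier_vec (2 * n)" "w \<in> carrier_vec (2 * m)" "v = z @\<^sub>v w"
    using split_append_vec[OF v] .
  \<comment> \<open>With all matrix coordinates zero only the blocks
    \<open>- inverse \<beta>1 I\<close> and \<open>- inverse \<beta>2 I\<close> act, and these are
    the preimages of \<open>z\<close> and \<open>w\<close>. In terms of perturbations, changing the
    right-hand side alone is enough.\<close>
  let ?z = "- \<beta>1 \<cdot>\<^sub>v z" and ?w = "- \<beta>2 \<cdot>\<^sub>v w"
  have c: "?z \<in> carrier_vec (2 * n)" "?w \<in> carrier_vec (2 * m)" using zw by simp_all
  have zero: "A *\<^sub>v 0\<^sub>v k = 0\<^sub>v j" if "A \<in> carrier_mat j k" for A :: "real mat" and j k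
    using that by (auto intro!: eq_vecI)
  have scale: "0\<^sub>v k - inverse \<beta> \<cdot>\<^sub>v (- \<beta> \<cdot>\<^sub>v t) = t" if "t \<in> carrier_vec k" "\<beta> > 0"
    for t :: "real vec" and k \<beta>
    using that by (auto intro!: eq_vecI)
  have "K *\<^sub>v ((0\<^sub>v d1 @\<^sub>v 0\<^sub>v d2) @\<^sub>v (?z @\<^sub>v ?w)) = v"
    unfolding K_mult_vec[OF zero_carrier_vec zero_carrier_vec c] zero[OF X1(1)] zero[OF M2h(1)]
      scale[OF zw(1) pos(5)] scale[OF zw(2) pos(6)] zw(3) ..
  moreover have "(0\<^sub>v d1 @\<^sub>v 0\<^sub>v d2) @\<^sub>v (?z @\<^sub>v ?w) \<in> carrier_vec ((d1 + d2) + (2 * n + 2 * m))"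
    using c by (auto intro!: carrier_vecI)
  ultimately show ?thesis by blast
qed

text \<open>Moving the unperturbed terms to the right turns them into the residuals, and moving
  \<open>s\<close> and \<open>t\<close> to the left gives them a minus sign. This is the origin of
  the negative blocks in \<open>I1\<close> and \<open>I2\<close>.\<close>

lemma saddle_equation_iff:
  assumes Y: "Y \<in> carrier_mat n n" and Z: "Z \<in> carrier_mat m n"
    and W: "W \<in> carrier_mat m n" and V: "V \<in> carrier_mat m m"
    and s: "s \<in> carrier_vec n" and t: "t \<in> carrier_vec m"
  shows "saddle_mat (E + Y) (F + Z) (H + W) (G + V) *\<^sub>v (u @\<^sub>v p) = (q + s) @\<^sub>v (r + t) \<longleftrightarrow>
    (Y *\<^sub>v u + mat_adjoint Z *\<^sub>v p) - s = Q \<and> (W *\<^sub>v u + V *\<^sub>v p) - t = R"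
proof -
  have move: "(a + b) + (c + d) = e + f \<longleftrightarrow> (b + d) - f = e - a - c"
    if "a \<in> carrier_vec k" "b \<in> carrier_vec k" "c \<in> carrier_vec k" "d \<in> carrier_vec k"
      "e \<in> carrier_vec k" "f \<in> carrier_vec k" for a b c d e f :: "complex vec" and k
    using that by (auto simp: vec_eq_iff algebra_simps)
  note adj = mat_adjoint_carrier[OF F] mat_adjoint_carrier[OF Z]
  have FZ: "mat_adjoint (F + Z) \<in> carrier_mat n m"
    unfolding mat_adjoint_add[OF F Z] using adj by simp
  have "saddle_mat (E + Y) (F + Z) (H + W) (G + V) *\<^sub>v (u @\<^sub>v p) =
      ((E + Y) *\<^sub>v u + mat_adjoint (F + Z) *\<^sub>v p) @\<^sub>v ((H + W) *\<^sub>v u + (G + V) *\<^sub>v p)"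
    unfolding saddle_mat_def
    by (rule four_block_mat_mult_vec[of _ n n _ m _ m]) (use E G H Y W V u p FZ in auto)
  also have "\<dots> = ((E *\<^sub>v u + Y *\<^sub>v u) + (mat_adjoint F *\<^sub>v p + mat_adjoint Z *\<^sub>v p)) @\<^sub>v
      ((H *\<^sub>v u + W *\<^sub>v u) + (G *\<^sub>v p + V *\<^sub>v p))"
    unfolding mat_adjoint_add[OF F Z] add_mult_distrib_mat_vec[OF E(1) Y u]
      add_mult_distrib_mat_vec[OF adj p] add_mult_distrib_mat_vec[OF H W u]
      add_mult_distrib_mat_vec[OF G(1) V p] ..
  finally have "saddle_mat (E + Y) (F + Z) (H + W) (G + V) *\<^sub>v (u @\<^sub>v p) = (q + s) @\<^sub>v (r + t) \<longleftrightarrow>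
      (E *\<^sub>v u + Y *\<^sub>v u) + (mat_adjoint F *\<^sub>v p + mat_adjoint Z *\<^sub>v p) = q + s \<and>
      (H *\<^sub>v u + W *\<^sub>v u) + (G *\<^sub>v p + V *\<^sub>v p) = r + t"
    using E Y u p q s adj by (simp add: append_vec_eq[of _ n])
  also have "\<dots> \<longleftrightarrow> (Y *\<^sub>v u + mat_adjoint Z *\<^sub>v p) - s = Q \<and> (W *\<^sub>v u + V *\<^sub>v p) - t = R"
    unfolding Q_def R_def
    by (intro conj_cong move[of _ n] move[of _ m]) (use E G H Y W V u p q r s t adj in auto)
  finally show ?thesis .
qed

text \<open>The unknown vector of the linear system: real coordinates of the masked perturbation, scaled
  so that its Euclidean norm is the weighted norm of the perturbation.\<close>

definition coords :: "real vec \<Rightarrow> real vec \<Rightarrow> real vec \<Rightarrow> real vec \<Rightarrow> real vec \<Rightarrow> real vec \<Rightarrow> real vec \<Rightarrow>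
    real vec \<Rightarrow> complex vec \<Rightarrow> complex vec \<Rightarrow> real vec" where
  "coords a b f g h k c d s t =
    ((a @\<^sub>v b @\<^sub>v f @\<^sub>v g) @\<^sub>v (h @\<^sub>v k @\<^sub>v c @\<^sub>v d)) @\<^sub>v
    (\<beta>1 \<cdot>\<^sub>v (map_vec Re s @\<^sub>v map_vec Im s) @\<^sub>v \<beta>2 \<cdot>\<^sub>v (map_vec Re t @\<^sub>v map_vec Im t))"

text \<open>The sum is grouped by perturbation block so that it can be compared with
  \<open>weighted_norm_power2\<close> summand by summand.\<close>

lemma norm2_coords:
  "(norm2 (coords a b f g h k c d s t))\<^sup>2 =
    ((norm2 a)\<^sup>2 + (norm2 b)\<^sup>2) + ((norm2 f)\<^sup>2 + (norm2 g)\<^sup>2) + ((norm2 h)\<^sup>2 + (norm2 k)\<^sup>2) +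
    ((norm2 c)\<^sup>2 + (norm2 d)\<^sup>2) + \<beta>1\<^sup>2 * (norm2 s)\<^sup>2 + \<beta>2\<^sup>2 * (norm2 t)\<^sup>2"
  by (simp add: coords_def norm2_sq_append norm2_sq_smult norm2_complex_parts[of s]
      norm2_complex_parts[of t])

lemma coords_dims:
  assumes "a \<in> carrier_vec (n * (n + 1) div 2)" "b \<in> carrier_vec (n * (n - 1) div 2)"
    "f \<in> carrier_vec (m * n)" "g \<in> carrier_vec (m * n)"
    "h \<in> carrier_vec (m * n)" "k \<in> carrier_vec (m * n)"
    "c \<in> carrier_vec (m * (m + 1) div 2)" "d \<in> carrier_vec (m * (m - 1) div 2)"
    "s \<in> carrier_vec n" "t \<in> carrier_vec m"
  shows "a @\<^sub>v b @\<^sub>v f @\<^sub>v g \<in> carrier_vec d1" "h @\<^sub>v k @\<^sub>v c @\<^sub>v d \<in> carrier_vec d2"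
    "\<beta>1 \<cdot>\<^sub>v (map_vec Re s @\<^sub>v map_vec Im s) \<in> carrier_vec (2 * n)"
    "\<beta>2 \<cdot>\<^sub>v (map_vec Re t @\<^sub>v map_vec Im t) \<in> carrier_vec (2 * m)"
    "coords a b f g h k c d s t \<in> carrier_vec ((d1 + d2) + (2 * n + 2 * m))"
proof -
  have dims: "dim_vec a = n * (n + 1) div 2" "dim_vec b = n * (n - 1) div 2" "dim_vec f = m * n"
    "dim_vec g = m * n" "dim_vec h = m * n" "dim_vec k = m * n" "dim_vec c = m * (m + 1) div 2"
    "dim_vec d = m * (m - 1) div 2" "dim_vec s = n" "dim_vec t = m"
    using assms by (auto dest: carrier_vecD)
  show 1: "a @\<^sub>v b @\<^sub>v f @\<^sub>v g \<in> carrier_vec d1"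
    using triangle_dims[of n] by (intro carrier_vecI) (simp add: dims)
  show 2: "h @\<^sub>v k @\<^sub>v c @\<^sub>v d \<in> carrier_vec d2"
    using triangle_dims[of m] by (intro carrier_vecI) (simp add: dims)
  show 3: "\<beta>1 \<cdot>\<^sub>v (map_vec Re s @\<^sub>v map_vec Im s) \<in> carrier_vec (2 * n)"
    "\<beta>2 \<cdot>\<^sub>v (map_vec Re t @\<^sub>v map_vec Im t) \<in> carrier_vec (2 * m)"
    by (intro carrier_vecI; simp add: dims)+
  show "coords a b f g h k c d s t \<in> carrier_vec ((d1 + d2) + (2 * n + 2 * m))"
    unfolding coords_def by (intro append_carrier_vec 1 2 3)
qed

text \<open>The hypotheses do not say that the coordinates were computed from the matrices, only
  that their images agree. The equivalence thus applies both to the coordinates of a given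
  perturbation and to an arbitrary solution with components outside the pattern.\<close>

lemma K_coords_iff:
  assumes carr: "Y \<in> carrier_mat n n" "Z \<in> carrier_mat m n" "W \<in> carrier_mat m n" "V \<in> carrier_mat m m"
    and dims: "a \<in> carrier_vec (n * (n + 1) div 2)" "b \<in> carrier_vec (n * (n - 1) div 2)"
    "f \<in> carrier_vec (m * n)" "g \<in> carrier_vec (m * n)"
    "h \<in> carrier_vec (m * n)" "k \<in> carrier_vec (m * n)"
    "c \<in> carrier_vec (m * (m + 1) div 2)" "d \<in> carrier_vec (m * (m - 1) div 2)"
    "s \<in> carrier_vec n" "t \<in> carrier_vec m"
    and Y: "N_S E *\<^sub>v a = \<alpha>1 \<cdot>\<^sub>v vec_cols (map_mat Re Y)" "N_SK E *\<^sub>v b = \<alpha>1 \<cdot>\<^sub>v vec_cols (map_mat Im Y)"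
    and Z: "Sigma_mat F *\<^sub>v f = \<alpha>2 \<cdot>\<^sub>v vec_cols (map_mat Re Z)"
      "Sigma_mat F *\<^sub>v g = \<alpha>2 \<cdot>\<^sub>v vec_cols (map_mat Im Z)"
    and W: "Sigma_mat H *\<^sub>v h = \<alpha>3 \<cdot>\<^sub>v vec_cols (map_mat Re W)"
      "Sigma_mat H *\<^sub>v k = \<alpha>3 \<cdot>\<^sub>v vec_cols (map_mat Im W)"
    and V: "N_S G *\<^sub>v c = \<alpha>4 \<cdot>\<^sub>v vec_cols (map_mat Re V)" "N_SK G *\<^sub>v d = \<alpha>4 \<cdot>\<^sub>v vec_cols (map_mat Im V)"
  shows "K *\<^sub>v coords a b f g h k c d s t = rhs \<longleftrightarrow>
    saddle_mat (E + Y) (F + Z) (H + W) (G + V) *\<^sub>v (u @\<^sub>v p) = (q + s) @\<^sub>v (r + t)"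
proof -
  let ?S = "Y *\<^sub>v u + mat_adjoint Z *\<^sub>v p" and ?T = "W *\<^sub>v u + V *\<^sub>v p"
  have S: "?S \<in> carrier_vec n" and T: "?T \<in> carrier_vec m"
    using carr u p mat_adjoint_carrier[OF carr(2)] by simp_all
  have X1S: "X1_hat n \<alpha>1 \<alpha>2 E F u p *\<^sub>v (a @\<^sub>v b @\<^sub>v f @\<^sub>v g) = map_vec Re ?S @\<^sub>v map_vec Im ?S"
    by (rule X1(2)) fact+
  have M2T: "M2_hat m \<alpha>3 \<alpha>4 H G u p *\<^sub>v (h @\<^sub>v k @\<^sub>v c @\<^sub>v d) = map_vec Re ?T @\<^sub>v map_vec Im ?T"
    by (rule M2h(2)) fact+
  have unscale: "(map_vec Re v @\<^sub>v map_vec Im v) - inverse \<beta> \<cdot>\<^sub>v (\<beta> \<cdot>\<^sub>v (map_vec Re w @\<^sub>v map_vec Im w)) =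
      map_vec Re (v - w) @\<^sub>v map_vec Im (v - w)"
    if "v \<in> carrier_vec j" "w \<in> carrier_vec j" "\<beta> > 0" for v w j and \<beta> :: real
    using that by (auto intro!: eq_vecI)
  have "K *\<^sub>v coords a b f g h k c d s t =
      (map_vec Re (?S - s) @\<^sub>v map_vec Im (?S - s)) @\<^sub>v (map_vec Re (?T - t) @\<^sub>v map_vec Im (?T - t))"
    unfolding coords_def K_mult_vec[OF coords_dims(1-4)[OF dims]] X1S M2T
      unscale[OF S dims(9) pos(5)] unscale[OF T dims(10) pos(6)] ..
  also have "\<dots> = rhs \<longleftrightarrow> map_vec Re (?S - s) = map_vec Re Q \<and> map_vec Im (?S - s) = map_vec Im Q \<and>
      map_vec Re (?T - t) = map_vec Re R \<and> map_vec Im (?T - t) = map_vec Im R"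
  proof -
    have c: "map_vec Re v @\<^sub>v map_vec Im v \<in> carrier_vec (j + j)" "map_vec Re v \<in> carrier_vec j"
      if "v \<in> carrier_vec j" for v j
      using that by (auto intro!: carrier_vecI)
    have Ss: "?S - s \<in> carrier_vec n" and Tt: "?T - t \<in> carrier_vec m"
      using S T dims by simp_all
    show ?thesis
      unfolding rhs_append append_vec_eq[OF c(1)[OF Ss] c(1)[OF QR_carrier(1)]]
        append_vec_eq[OF c(2)[OF Ss] c(2)[OF QR_carrier(1)]]
        append_vec_eq[OF c(2)[OF Tt] c(2)[OF QR_carrier(2)]] by blast
  qed
  also have "\<dots> \<longleftrightarrow> ?S - s = Q \<and> ?T - t = R"
    using map_vec_Re_Im_eqD by metis
  also have "\<dots> \<longleftrightarrow> saddle_mat (E + Y) (F + Z) (H + W) (G + V) *\<^sub>v (u @\<^sub>v p) = (q + s) @\<^sub>v (r + t)"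
    by (rule saddle_equation_iff[symmetric]) fact+
  finally show ?thesis .
qed

section \<open>Comparison of feasible values with norms of solutions\<close>

abbreviation "weighted_norm \<equiv> zeta \<alpha>1 \<alpha>2 \<alpha>3 \<alpha>4 \<beta>1 \<beta>2"

lemma weighted_norm_power2:
  "(weighted_norm (Y, Z, W, V, s, t))\<^sup>2 = \<alpha>1\<^sup>2 * (norm_F Y)\<^sup>2 + \<alpha>2\<^sup>2 * (norm_F Z)\<^sup>2 +
    \<alpha>3\<^sup>2 * (norm_F W)\<^sup>2 + \<alpha>4\<^sup>2 * (norm_F V)\<^sup>2 + \<beta>1\<^sup>2 * (norm2 s)\<^sup>2 + \<beta>2\<^sup>2 * (norm2 t)\<^sup>2"
  by (simp add: zeta_def)

lemma weighted_norm_nonneg: "0 \<le> weighted_norm x"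
  by (cases x) (simp add: zeta_def)

text \<open>This direction supplies the lower bound: a masked perturbation has coordinates of
  exactly its own norm, hence no feasible value lies below the least norm of a solution.\<close>

lemma feasible_imp_solution:
  assumes x: "x \<in> G3 n m E F H G q r u p" "mask E F H G x = x"
  obtains y where "y \<in> carrier_vec ((d1 + d2) + (2 * n + 2 * m))" "K *\<^sub>v y = rhs"
    "norm2 y = weighted_norm x"
proof -
  obtain Y Z W V s t where xx: "x = (Y, Z, W, V, s, t)" by (cases x)
  have carr: "Y \<in> carrier_mat n n" "Z \<in> carrier_mat m n" "W \<in> carrier_mat m n" "V \<in> carrier_mat m m"
    and st: "s \<in> carrier_vec n" "t \<in> carrier_vec m"
    and herm: "hermitian_mat Y" "hermitian_mat V"
    and eq: "saddle_mat (E + Y) (F + Z) (H + W) (G + V) *\<^sub>v (u @\<^sub>v p) = (q + s) @\<^sub>v (r + t)"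
    using x(1) by (auto simp: G3_def xx)
  have sparse: "Y \<odot>\<^sub>m Theta E = Y" "Z \<odot>\<^sub>m Theta F = Z" "W \<odot>\<^sub>m Theta H = W" "V \<odot>\<^sub>m Theta G = V"
    using x(2) by (auto simp: mask_def xx)
  obtain a b where ab: "a \<in> carrier_vec (n * (n + 1) div 2)" "b \<in> carrier_vec (n * (n - 1) div 2)"
    "N_S E *\<^sub>v a = \<alpha>1 \<cdot>\<^sub>v vec_cols (map_mat Re Y)" "N_SK E *\<^sub>v b = \<alpha>1 \<cdot>\<^sub>v vec_cols (map_mat Im Y)"
    "(norm2 a)\<^sup>2 + (norm2 b)\<^sup>2 = \<alpha>1\<^sup>2 * (norm_F Y)\<^sup>2"
    using hermitian_coords_surj[OF E carr(1) herm(1) sparse(1)] .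
  obtain f g where fg: "f \<in> carrier_vec (m * n)" "g \<in> carrier_vec (m * n)"
    "Sigma_mat F *\<^sub>v f = \<alpha>2 \<cdot>\<^sub>v vec_cols (map_mat Re Z)"
    "Sigma_mat F *\<^sub>v g = \<alpha>2 \<cdot>\<^sub>v vec_cols (map_mat Im Z)"
    "(norm2 f)\<^sup>2 + (norm2 g)\<^sup>2 = \<alpha>2\<^sup>2 * (norm_F Z)\<^sup>2"
    using general_coords_surj[OF F carr(2) sparse(2)] .
  obtain h k where hk: "h \<in> carrier_vec (m * n)" "k \<in> carrier_vec (m * n)"
    "Sigma_mat H *\<^sub>v h = \<alpha>3 \<cdot>\<^sub>v vec_cols (map_mat Re W)"
    "Sigma_mat H *\<^sub>v k = \<alpha>3 \<cdot>\<^sub>v vec_cols (map_mat Im W)"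
    "(norm2 h)\<^sup>2 + (norm2 k)\<^sup>2 = \<alpha>3\<^sup>2 * (norm_F W)\<^sup>2"
    using general_coords_surj[OF H carr(3) sparse(3)] .
  obtain c d where cd: "c \<in> carrier_vec (m * (m + 1) div 2)" "d \<in> carrier_vec (m * (m - 1) div 2)"
    "N_S G *\<^sub>v c = \<alpha>4 \<cdot>\<^sub>v vec_cols (map_mat Re V)" "N_SK G *\<^sub>v d = \<alpha>4 \<cdot>\<^sub>v vec_cols (map_mat Im V)"
    "(norm2 c)\<^sup>2 + (norm2 d)\<^sup>2 = \<alpha>4\<^sup>2 * (norm_F V)\<^sup>2"
    using hermitian_coords_surj[OF G carr(4) herm(2) sparse(4)] .
  note dims = ab(1,2) fg(1,2) hk(1,2) cd(1,2) st
  have "K *\<^sub>v coords a b f g h k c d s t = rhs"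
    using eq K_coords_iff[OF carr dims ab(3,4) fg(3,4) hk(3,4) cd(3,4)] by blast
  moreover have "(norm2 (coords a b f g h k c d s t))\<^sup>2 = (weighted_norm x)\<^sup>2"
    unfolding norm2_coords xx weighted_norm_power2 ab(5) fg(5) hk(5) cd(5) ..
  then have "norm2 (coords a b f g h k c d s t) = weighted_norm x"
    using norm2_nonneg weighted_norm_nonneg by (rule power2_eq_imp_eq)
  ultimately show ?thesis using that coords_dims(5)[OF dims] by blast
qed

text \<open>This direction supplies attainment: any \<open>y\<close> can be cut into coordinate
  segments, and each pair of segments is the image of a sparse block of no larger weighted
  norm.\<close>

lemma solution_imp_feasible:
  assumes y: "y \<in> carrier_vec ((d1 + d2) + (2 * n + 2 * m))" and Ky: "K *\<^sub>v y = rhs"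
  obtains x where "x \<in> G3 n m E F H G q r u p" "mask E F H G x = x" "weighted_norm x \<le> norm2 y"
proof -
  \<comment> \<open>The column counts are rewritten as sums of segment lengths, nested to the right
    like the appended vectors in \<open>coords\<close>.\<close>
  have d1: "d1 = n * (n + 1) div 2 + (n * (n - 1) div 2 + (m * n + m * n))"
    using triangle_dims[of n] by simp
  have d2: "d2 = m * n + (m * n + (m * (m + 1) div 2 + m * (m - 1) div 2))"
    using triangle_dims[of m] by simp
  obtain x z where xz: "x \<in> carrier_vec (d1 + d2)" "z \<in> carrier_vec (2 * n + 2 * m)" "y = x @\<^sub>v z"
    using split_append_vec[OF y] .
  obtain x1 x2 where x12: "x1 \<in> carrier_vec d1" "x2 \<in> carrier_vec d2" "x = x1 @\<^sub>v x2"
    using split_append_vec[OF xz(1)] .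
  obtain z1 z2 where z12: "z1 \<in> carrier_vec (2 * n)" "z2 \<in> carrier_vec (2 * m)" "z = z1 @\<^sub>v z2"
    using split_append_vec[OF xz(2)] .
  obtain a bfg where a: "a \<in> carrier_vec (n * (n + 1) div 2)"
    "bfg \<in> carrier_vec (n * (n - 1) div 2 + (m * n + m * n))" "x1 = a @\<^sub>v bfg"
    using split_append_vec[OF x12(1)[unfolded d1]] .
  obtain b fg where b: "b \<in> carrier_vec (n * (n - 1) div 2)" "fg \<in> carrier_vec (m * n + m * n)"
    "bfg = b @\<^sub>v fg"
    using split_append_vec[OF a(2)] .
  obtain f g where fg: "f \<in> carrier_vec (m * n)" "g \<in> carrier_vec (m * n)" "fg = f @\<^sub>v g"
    using split_append_vec[OF b(2)] .
  obtain h kcd where h: "h \<in> carrier_vec (m * n)"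
    "kcd \<in> carrier_vec (m * n + (m * (m + 1) div 2 + m * (m - 1) div 2))" "x2 = h @\<^sub>v kcd"
    using split_append_vec[OF x12(2)[unfolded d2]] .
  obtain k cd where k: "k \<in> carrier_vec (m * n)"
    "cd \<in> carrier_vec (m * (m + 1) div 2 + m * (m - 1) div 2)" "kcd = k @\<^sub>v cd"
    using split_append_vec[OF h(2)] .
  obtain c d where cd: "c \<in> carrier_vec (m * (m + 1) div 2)" "d \<in> carrier_vec (m * (m - 1) div 2)"
    "cd = c @\<^sub>v d"
    using split_append_vec[OF k(2)] .
  \<comment> \<open>No mask acts on the right-hand side, so its perturbations are recovered exactly
    by dividing out the positive factor.\<close>
  have parts: "\<exists>s. s \<in> carrier_vec j \<and> v = \<beta> \<cdot>\<^sub>v (map_vec Re s @\<^sub>v map_vec Im s)"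
    if v: "v \<in> carrier_vec (2 * j)" and \<beta>: "\<beta> > 0" for v j and \<beta> :: real
  proof -
    have "inverse \<beta> \<cdot>\<^sub>v v \<in> carrier_vec (j + j)" using v by (simp add: mult_2)
    then obtain v1 v2 where v12: "v1 \<in> carrier_vec j" "v2 \<in> carrier_vec j" "inverse \<beta> \<cdot>\<^sub>v v = v1 @\<^sub>v v2"
      using split_append_vec by blast
    obtain s where s: "s \<in> carrier_vec j" "map_vec Re s = v1" "map_vec Im s = v2"
      using ex_complex_vec[OF v12(1,2)] .
    have "\<beta> \<cdot>\<^sub>v (v1 @\<^sub>v v2) = v"
      unfolding v12(3)[symmetric] using \<beta> by (simp add: smult_smult_assoc)
    then show ?thesis using s by blast
  qed
  obtain s where s: "s \<in> carrier_vec n" "z1 = \<beta>1 \<cdot>\<^sub>v (map_vec Re s @\<^sub>v map_vec Im s)"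
    using parts[OF z12(1) pos(5)] by blast
  obtain t where t: "t \<in> carrier_vec m" "z2 = \<beta>2 \<cdot>\<^sub>v (map_vec Re t @\<^sub>v map_vec Im t)"
    using parts[OF z12(2) pos(6)] by blast
  have yc: "y = coords a b f g h k c d s t"
    unfolding coords_def xz x12 z12 a b fg h k cd s t ..
  have nz: "\<alpha>1 \<noteq> 0" "\<alpha>2 \<noteq> 0" "\<alpha>3 \<noteq> 0" "\<alpha>4 \<noteq> 0" using pos by simp_all
  obtain Y where Y: "Y \<in> carrier_mat n n" "hermitian_mat Y" "Y \<odot>\<^sub>m Theta E = Y"
    "N_S E *\<^sub>v a = \<alpha>1 \<cdot>\<^sub>v vec_cols (map_mat Re Y)" "N_SK E *\<^sub>v b = \<alpha>1 \<cdot>\<^sub>v vec_cols (map_mat Im Y)"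
    "\<alpha>1\<^sup>2 * (norm_F Y)\<^sup>2 \<le> (norm2 a)\<^sup>2 + (norm2 b)\<^sup>2"
    using hermitian_coords_image[OF E nz(1) a(1) b(1)] .
  obtain Z where Z: "Z \<in> carrier_mat m n" "Z \<odot>\<^sub>m Theta F = Z"
    "Sigma_mat F *\<^sub>v f = \<alpha>2 \<cdot>\<^sub>v vec_cols (map_mat Re Z)"
    "Sigma_mat F *\<^sub>v g = \<alpha>2 \<cdot>\<^sub>v vec_cols (map_mat Im Z)"
    "\<alpha>2\<^sup>2 * (norm_F Z)\<^sup>2 \<le> (norm2 f)\<^sup>2 + (norm2 g)\<^sup>2"
    using general_coords_image[OF F nz(2) fg(1,2)] .
  obtain W where W: "W \<in> carrier_mat m n" "W \<odot>\<^sub>m Theta H = W"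
    "Sigma_mat H *\<^sub>v h = \<alpha>3 \<cdot>\<^sub>v vec_cols (map_mat Re W)"
    "Sigma_mat H *\<^sub>v k = \<alpha>3 \<cdot>\<^sub>v vec_cols (map_mat Im W)"
    "\<alpha>3\<^sup>2 * (norm_F W)\<^sup>2 \<le> (norm2 h)\<^sup>2 + (norm2 k)\<^sup>2"
    using general_coords_image[OF H nz(3) h(1) k(1)] .
  obtain V where V: "V \<in> carrier_mat m m" "hermitian_mat V" "V \<odot>\<^sub>m Theta G = V"
    "N_S G *\<^sub>v c = \<alpha>4 \<cdot>\<^sub>v vec_cols (map_mat Re V)" "N_SK G *\<^sub>v d = \<alpha>4 \<cdot>\<^sub>v vec_cols (map_mat Im V)"
    "\<alpha>4\<^sup>2 * (norm_F V)\<^sup>2 \<le> (norm2 c)\<^sup>2 + (norm2 d)\<^sup>2"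
    using hermitian_coords_image[OF G nz(4) cd(1,2)] .
  note dims = a(1) b(1) fg(1,2) h(1) k(1) cd(1,2) s(1) t(1)
  show ?thesis
  proof (rule that[of "(Y, Z, W, V, s, t)"])
    have "saddle_mat (E + Y) (F + Z) (H + W) (G + V) *\<^sub>v (u @\<^sub>v p) = (q + s) @\<^sub>v (r + t)"
      using Ky K_coords_iff[OF Y(1) Z(1) W(1) V(1) dims Y(4,5) Z(3,4) W(3,4) V(4,5)]
      unfolding yc by blast
    then show "(Y, Z, W, V, s, t) \<in> G3 n m E F H G q r u p"
      using Y(1,2) Z(1) W(1) V(1,2) s(1) t(1) by (simp add: G3_def)
    show "mask E F H G (Y, Z, W, V, s, t) = (Y, Z, W, V, s, t)"
      by (simp add: mask_def Y(3) Z(2) W(2) V(3))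
    have "(weighted_norm (Y, Z, W, V, s, t))\<^sup>2 \<le> (norm2 y)\<^sup>2"
      \<comment> \<open>The four matrix blocks contribute inequalities, the two right-hand side
        terms equalities.\<close>
      unfolding yc norm2_coords weighted_norm_power2 by (intro add_mono Y Z W V order_refl)
    then show "weighted_norm (Y, Z, W, V, s, t) \<le> norm2 y"
      using norm2_nonneg by (rule power2_le_imp_le)
  qed
qed

text \<open>\<open>sps_values\<close> ranges over unmasked tuples, while
  \<open>feasible_imp_solution\<close> expects a fixed point of \<open>mask\<close>.
  \<open>hadamard\<close> takes its dimensions from its left factor, so membership of the masked
  tuple in \<open>G3\<close> also determines the dimensions of the unmasked one.\<close>

lemma mask_idem:
  assumes "mask E F H G x \<in> G3 n m E F H G q r u p"
  shows "mask E F H G (mask E F H G x) = mask E F H G x"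
proof -
  obtain Y Z W V s t where xx: "x = (Y, Z, W, V, s, t)" by (cases x)
  have dim: "dim_row (A \<odot>\<^sub>m B) = dim_row A" "dim_col (A \<odot>\<^sub>m B) = dim_col A" for A B :: "complex mat"
    by (simp_all add: hadamard_def)
  have unmask: "A \<odot>\<^sub>m Theta X \<in> carrier_mat j k \<Longrightarrow> A \<in> carrier_mat j k" for A X :: "complex mat" and j k
    by (metis dim carrier_matD carrier_matI)
  have masked: "Y \<odot>\<^sub>m Theta E \<in> carrier_mat n n" "Z \<odot>\<^sub>m Theta F \<in> carrier_mat m n"
    "W \<odot>\<^sub>m Theta H \<in> carrier_mat m n" "V \<odot>\<^sub>m Theta G \<in> carrier_mat m m"
    using assms by (simp_all add: mask_def G3_def xx)
  show ?thesis
    using hadamard_Theta_idem[OF unmask[OF masked(1)] E(1)] hadamard_Theta_idem[OF unmask[OF masked(2)] F]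
      hadamard_Theta_idem[OF unmask[OF masked(3)] H] hadamard_Theta_idem[OF unmask[OF masked(4)] G(1)]
    by (simp add: mask_def xx)
qed

text \<open>A squeeze: every value is the norm of some solution and so at least
  \<open>norm2 y0\<close>, while the perturbation built from \<open>y0\<close> has a value of at
  most \<open>norm2 y0\<close>. That value equals \<open>norm2 y0\<close>, so the infimum is
  attained.\<close>

lemma backward_error:
  defines "y0 \<equiv> (transpose_mat K * inv_mat (K * transpose_mat K)) *\<^sub>v rhs"
    and "S \<equiv> sps_values n m \<alpha>1 \<alpha>2 \<alpha>3 \<alpha>4 \<beta>1 \<beta>2 E F H G q r u p"
  shows "invertible_mat (K * transpose_mat K)" "norm2 y0 \<in> S" "Inf S = norm2 y0"
proof -
  have det: "det (K * transpose_mat K) \<noteq> 0"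
    by (rule det_mult_transpose[OF K_carrier K_surj])
  have KK: "K * transpose_mat K \<in> carrier_mat (2 * n + 2 * m) (2 * n + 2 * m)"
    using K_carrier by simp
  show "invertible_mat (K * transpose_mat K)" by (rule inv_mat_inverse(4)[OF KK det])
  note least = least_norm_solution[OF K_carrier det rhs_carrier, folded y0_def]
  have lower: "norm2 y0 \<le> v" if "v \<in> S" for v
  proof -
    from that obtain x where x: "v = weighted_norm (mask E F H G x)"
      "mask E F H G x \<in> G3 n m E F H G q r u p"
      by (auto simp: S_def sps_values_def)
    obtain y where "y \<in> carrier_vec ((d1 + d2) + (2 * n + 2 * m))" "K *\<^sub>v y = rhs" "norm2 y = v"
      using feasible_imp_solution[OF x(2) mask_idem[OF x(2)]] unfolding x(1) .
    then show ?thesis using least(3) by blast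
  qed
  obtain x where x: "x \<in> G3 n m E F H G q r u p" "mask E F H G x = x" "weighted_norm x \<le> norm2 y0"
    using solution_imp_feasible[OF least(1,2)] .
  then have "weighted_norm x \<in> S"
    unfolding S_def sps_values_def mem_Collect_eq by (intro exI[of _ x]) simp
  with lower x(3) show mem: "norm2 y0 \<in> S" by (metis antisym)
  show "Inf S = norm2 y0" using mem lower by (intro cInf_eq_minimum)
qed

end

text \<open>The first two conjuncts give the formula its meaning: membership in
  \<open>sps_values\<close> turns the infimum into a minimum, and invertibility makes
  \<open>inv_mat\<close> the true inverse.\<close>

theorem theorem3p3:
  fixes n m :: nat
    and E F H G :: "complex mat"
    and q r u p :: "complex vec"
    and \<alpha>1 \<alpha>2 \<alpha>3 \<alpha>4 \<beta>1 \<beta>2 :: real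
  assumes "E \<in> carrier_mat n n" "hermitian_mat E"
    and "G \<in> carrier_mat m m" "hermitian_mat G"
    and "F \<in> carrier_mat m n" "H \<in> carrier_mat m n"
    and "q \<in> carrier_vec n" "r \<in> carrier_vec m"
    and "invertible_mat (saddle_mat E F H G)"
    and "\<alpha>1 > 0" "\<alpha>2 > 0" "\<alpha>3 > 0" "\<alpha>4 > 0" "\<beta>1 > 0" "\<beta>2 > 0"
    and "u \<in> carrier_vec n" "p \<in> carrier_vec m"
  shows
    "let Q = q - E *\<^sub>v u - mat_adjoint F *\<^sub>v p;
         R = r - H *\<^sub>v u - G *\<^sub>v p;
         K = four_block_mat (M1 n m \<alpha>1 \<alpha>2 E F u p) (I1 n m \<beta>1)
                            (M2 n m \<alpha>3 \<alpha>4 H G u p) (I2 n m \<beta>2);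
         b = map_vec Re Q @\<^sub>v map_vec Im Q @\<^sub>v map_vec Re R @\<^sub>v map_vec Im R;
         \<xi> = backward_error_sps n m \<alpha>1 \<alpha>2 \<alpha>3 \<alpha>4 \<beta>1 \<beta>2 E F H G q r u p
     in \<xi> \<in> sps_values n m \<alpha>1 \<alpha>2 \<alpha>3 \<alpha>4 \<beta>1 \<beta>2 E F H G q r u p \<and>
        invertible_mat (K * transpose_mat K) \<and>
        \<xi> = norm2 ((transpose_mat K * inv_mat (K * transpose_mat K)) *\<^sub>v b)"
proof -
  interpret P: sparse_saddle_problem n m E F H G q r u p \<alpha>1 \<alpha>2 \<alpha>3 \<alpha>4 \<beta>1 \<beta>2
    by unfold_locales fact+
  show ?thesis
    unfolding Let_def backward_error_sps_def
    using P.backward_error unfolding P.K_def P.rhs_def P.Q_def P.R_def by simp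
qed

end
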